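(* Let $\mathcal{R}$ be a variety of residuated lattices containing $\mathsf{CIRL}$. Let $\mathbf{A}\in\mathcal{R}$ be finite, subdirectly irreducible, commutative and integral. Then $\mathbf{A}$ is not a splitting algebra in $\mathcal{R}$. In particular, the variety $\mathsf{CIRL}$ has no splittings (there is no splitting pair in the lattice of subvarieties of $\mathsf{CIRL}$).
   Context: A residuated lattice is an algebra $\mathbf{A}=\langle A;\wedge,\vee,\backslash,/,\cdot,1\rangle$ such that $\langle A;\wedge,\vee\rangle$ is a lattice, $\langle A;\cdot,1\rangle$ is a monoid, and $y\leq x\backslash z \iff xy\leq z\iff x\leq z/y$ for all $x,y,z\in A$. It is integral if $x\leq 1$ for all $x$, and commutative if $xy=yx$ for all $x,y$. $\mathsf{CIRL}$ is the variety of all commutative integral residuated lattices. A pair $(c,d)$ of elements of a lattice $L$ is a splitting pair if $L$ is the disjoint union of $\{x\mid x\geq c\}$ and $\{x\mid x\leq d\}$. A finitely generated subdirectly irreducible algebra $\mathbf{A}$ in a variety $\mathcal{V}$ is a splitting algebra in $\mathcal{V}$ if the variety $\mathrm{Var}(\mathbf{A})$ generated by $\mathbf{A}$ is completely join-prime in the lattice of subvarieties of $\mathcal{V}$ ($c$ is completely join-prime if $c\leq\bigvee S$ implies $c\leq s$ for some $s\in S$). *)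

theory Defs
  imports "HOL-Algebra.Algebra" "HOL-Library.Infinite_Typeclass"
begin

section \<open>Residuated lattices\<close>

text \<open>\<open>x \<setminus> z\<close> is the left division and \<open>z \<div> y\<close> the right division of the
  residuated lattice.\<close>

record 'a rlat = "'a monoid" +
  rl_meet :: "'a \<Rightarrow> 'a \<Rightarrow> 'a" (infixl "\<curlywedge>\<index>" 65)
  rl_join :: "'a \<Rightarrow> 'a \<Rightarrow> 'a" (infixl "\<curlyvee>\<index>" 60)
  ldiv :: "'a \<Rightarrow> 'a \<Rightarrow> 'a" (infixl "\<setminus>\<index>" 68)
  rdiv :: "'a \<Rightarrow> 'a \<Rightarrow> 'a" (infixl "\<div>\<index>" 68)

definition rl_le :: "('a, 'b) rlat_scheme \<Rightarrow> 'a \<Rightarrow> 'a \<Rightarrow> bool" (infix "\<preceq>\<index>" 50)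
  where "x \<preceq>\<^bsub>A\<^esub> y \<longleftrightarrow> x \<curlywedge>\<^bsub>A\<^esub> y = x"

locale residuated_lattice = monoid A for A (structure) +
  assumes meet_closed [intro, simp]:
      "\<lbrakk>x \<in> carrier A; y \<in> carrier A\<rbrakk> \<Longrightarrow> x \<curlywedge> y \<in> carrier A"
    and join_closed [intro, simp]:
      "\<lbrakk>x \<in> carrier A; y \<in> carrier A\<rbrakk> \<Longrightarrow> x \<curlyvee> y \<in> carrier A"
    and ldiv_closed [intro, simp]:
      "\<lbrakk>x \<in> carrier A; y \<in> carrier A\<rbrakk> \<Longrightarrow> x \<setminus> y \<in> carrier A"
    and rdiv_closed [intro, simp]:
      "\<lbrakk>x \<in> carrier A; y \<in> carrier A\<rbrakk> \<Longrightarrow> x \<div> y \<in> carrier A"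
    and meet_assoc:
      "\<lbrakk>x \<in> carrier A; y \<in> carrier A; z \<in> carrier A\<rbrakk> \<Longrightarrow> (x \<curlywedge> y) \<curlywedge> z = x \<curlywedge> (y \<curlywedge> z)"
    and join_assoc:
      "\<lbrakk>x \<in> carrier A; y \<in> carrier A; z \<in> carrier A\<rbrakk> \<Longrightarrow> (x \<curlyvee> y) \<curlyvee> z = x \<curlyvee> (y \<curlyvee> z)"
    and meet_comm: "\<lbrakk>x \<in> carrier A; y \<in> carrier A\<rbrakk> \<Longrightarrow> x \<curlywedge> y = y \<curlywedge> x"
    and join_comm: "\<lbrakk>x \<in> carrier A; y \<in> carrier A\<rbrakk> \<Longrightarrow> x \<curlyvee> y = y \<curlyvee> x"
    and meet_absorb: "\<lbrakk>x \<in> carrier A; y \<in> carrier A\<rbrakk> \<Longrightarrow> x \<curlywedge> (x \<curlyvee> y) = x"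
    and join_absorb: "\<lbrakk>x \<in> carrier A; y \<in> carrier A\<rbrakk> \<Longrightarrow> x \<curlyvee> (x \<curlywedge> y) = x"
    and ldiv_residual:
      "\<lbrakk>x \<in> carrier A; y \<in> carrier A; z \<in> carrier A\<rbrakk> \<Longrightarrow> y \<preceq> x \<setminus> z \<longleftrightarrow> x \<otimes> y \<preceq> z"
    and rdiv_residual:
      "\<lbrakk>x \<in> carrier A; y \<in> carrier A; z \<in> carrier A\<rbrakk> \<Longrightarrow> x \<otimes> y \<preceq> z \<longleftrightarrow> x \<preceq> z \<div> y"

definition commutative :: "('a, 'b) rlat_scheme \<Rightarrow> bool" where
  "commutative A \<longleftrightarrow> (\<forall>x\<in>carrier A. \<forall>y\<in>carrier A. x \<otimes>\<^bsub>A\<^esub> y = y \<otimes>\<^bsub>A\<^esub> x)"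

definition integral :: "('a, 'b) rlat_scheme \<Rightarrow> bool" where
  "integral A \<longleftrightarrow> (\<forall>x\<in>carrier A. x \<preceq>\<^bsub>A\<^esub> \<one>\<^bsub>A\<^esub>)"

definition CIRL :: "'a rlat set" where
  "CIRL = {A. residuated_lattice A \<and> commutative A \<and> integral A}"


section \<open>Subalgebras and congruences\<close>

definition subuniverse :: "('a, 'b) rlat_scheme \<Rightarrow> 'a set \<Rightarrow> bool" where
  "subuniverse A S \<longleftrightarrow> S \<subseteq> carrier A \<and> \<one>\<^bsub>A\<^esub> \<in> S \<and>
     (\<forall>x\<in>S. \<forall>y\<in>S. x \<otimes>\<^bsub>A\<^esub> y \<in> S \<and> x \<curlywedge>\<^bsub>A\<^esub> y \<in> S \<and> x \<curlyvee>\<^bsub>A\<^esub> y \<in> S \<and>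
        x \<setminus>\<^bsub>A\<^esub> y \<in> S \<and> x \<div>\<^bsub>A\<^esub> y \<in> S)"

definition finitely_generated :: "('a, 'b) rlat_scheme \<Rightarrow> bool" where
  "finitely_generated A \<longleftrightarrow> (\<exists>G. finite G \<and> G \<subseteq> carrier A \<and>
     (\<forall>S. subuniverse A S \<and> G \<subseteq> S \<longrightarrow> S = carrier A))"

definition rl_congruence :: "('a, 'b) rlat_scheme \<Rightarrow> ('a \<times> 'a) set \<Rightarrow> bool" where
  "rl_congruence A \<theta> \<longleftrightarrow> equiv (carrier A) \<theta> \<and>
     (\<forall>x x' y y'. (x, x') \<in> \<theta> \<and> (y, y') \<in> \<theta> \<longrightarrow>
        (x \<otimes>\<^bsub>A\<^esub> y, x' \<otimes>\<^bsub>A\<^esub> y') \<in> \<theta> \<and>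
        (x \<curlywedge>\<^bsub>A\<^esub> y, x' \<curlywedge>\<^bsub>A\<^esub> y') \<in> \<theta> \<and>
        (x \<curlyvee>\<^bsub>A\<^esub> y, x' \<curlyvee>\<^bsub>A\<^esub> y') \<in> \<theta> \<and>
        (x \<setminus>\<^bsub>A\<^esub> y, x' \<setminus>\<^bsub>A\<^esub> y') \<in> \<theta> \<and>
        (x \<div>\<^bsub>A\<^esub> y, x' \<div>\<^bsub>A\<^esub> y') \<in> \<theta>)"

text \<open>As in Burris and Sankappanavar, the one-element algebra counts as subdirectly
  irreducible; any other algebra is subdirectly irreducible iff it has a least nonidentity
  congruence. In the notion of splitting algebra below the convention on one-element algebras
  makes no difference: they generate the least subvariety, which is the empty join and
  hence not completely join-prime.\<close>

definition subdirectly_irreducible :: "('a, 'b) rlat_scheme \<Rightarrow> bool" where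
  "subdirectly_irreducible A \<longleftrightarrow> carrier A = {\<one>\<^bsub>A\<^esub>} \<or>
     (\<exists>\<mu>. rl_congruence A \<mu> \<and> \<mu> \<noteq> Id_on (carrier A) \<and>
        (\<forall>\<theta>. rl_congruence A \<theta> \<and> \<theta> \<noteq> Id_on (carrier A) \<longrightarrow> \<mu> \<subseteq> \<theta>))"


section \<open>Varieties\<close>

datatype rl_term =
    Var nat
  | One
  | Mult rl_term rl_term
  | Meet rl_term rl_term
  | Join rl_term rl_term
  | LDiv rl_term rl_term
  | RDiv rl_term rl_term

primrec eval :: "('a, 'b) rlat_scheme \<Rightarrow> (nat \<Rightarrow> 'a) \<Rightarrow> rl_term \<Rightarrow> 'a" where
  "eval A \<rho> (Var n) = \<rho> n"
| "eval A \<rho> One = \<one>\<^bsub>A\<^esub>"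
| "eval A \<rho> (Mult s t) = eval A \<rho> s \<otimes>\<^bsub>A\<^esub> eval A \<rho> t"
| "eval A \<rho> (Meet s t) = eval A \<rho> s \<curlywedge>\<^bsub>A\<^esub> eval A \<rho> t"
| "eval A \<rho> (Join s t) = eval A \<rho> s \<curlyvee>\<^bsub>A\<^esub> eval A \<rho> t"
| "eval A \<rho> (LDiv s t) = eval A \<rho> s \<setminus>\<^bsub>A\<^esub> eval A \<rho> t"
| "eval A \<rho> (RDiv s t) = eval A \<rho> s \<div>\<^bsub>A\<^esub> eval A \<rho> t"

definition satisfies :: "('a, 'b) rlat_scheme \<Rightarrow> rl_term \<times> rl_term \<Rightarrow> bool" where
  "satisfies A e \<longleftrightarrow>
     (\<forall>\<rho> \<in> UNIV \<rightarrow> carrier A. eval A \<rho> (fst e) = eval A \<rho> (snd e))"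

text \<open>Varieties are equational classes. HOL has no collection of algebras over all types, so
  a variety consists of algebras whose carriers are subsets of a type \<open>'u\<close>, which serves as the
  universe. For infinite \<open>'u\<close> nothing is lost: every variety of residuated lattices is
  determined by its free algebra on countably many generators, which has a copy
  in \<open>'u\<close>. So restricting to carriers in \<open>'u\<close> is an isomorphism from the lattice of all
  varieties of residuated lattices onto the lattice of the varieties defined here.\<close>

definition models :: "(rl_term \<times> rl_term) set \<Rightarrow> 'u rlat set" where
  "models E = {A. residuated_lattice A \<and> (\<forall>e\<in>E. satisfies A e)}"

definition variety :: "'u::infinite rlat set \<Rightarrow> bool" where
  "variety V \<longleftrightarrow> (\<exists>E. V = models E)"

definition generated_variety :: "'u::infinite rlat \<Rightarrow> 'u rlat set" where
  "generated_variety A = \<Inter>{V. variety V \<and> A \<in> V}"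

definition subvarieties :: "'u::infinite rlat set \<Rightarrow> 'u rlat set gorder" where
  "subvarieties V = \<lparr>carrier = {W. variety W \<and> W \<subseteq> V}, eq = (=), le = (\<subseteq>)\<rparr>"


section \<open>Splittings\<close>

definition completely_join_prime :: "('a, 'b) gorder_scheme \<Rightarrow> 'a \<Rightarrow> bool" where
  "completely_join_prime L c \<longleftrightarrow> c \<in> carrier L \<and>
     (\<forall>S. S \<subseteq> carrier L \<and> c \<sqsubseteq>\<^bsub>L\<^esub> \<Squnion>\<^bsub>L\<^esub> S \<longrightarrow> (\<exists>s\<in>S. c \<sqsubseteq>\<^bsub>L\<^esub> s))"

definition splitting_pair :: "('a, 'b) gorder_scheme \<Rightarrow> 'a \<Rightarrow> 'a \<Rightarrow> bool" where
  "splitting_pair L c d \<longleftrightarrow> c \<in> carrier L \<and> d \<in> carrier L \<and>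
     carrier L = {x \<in> carrier L. c \<sqsubseteq>\<^bsub>L\<^esub> x} \<union> {x \<in> carrier L. x \<sqsubseteq>\<^bsub>L\<^esub> d} \<and>
     {x \<in> carrier L. c \<sqsubseteq>\<^bsub>L\<^esub> x} \<inter> {x \<in> carrier L. x \<sqsubseteq>\<^bsub>L\<^esub> d} = {}"

definition splitting_algebra :: "'u::infinite rlat set \<Rightarrow> 'u rlat \<Rightarrow> bool" where
  "splitting_algebra V A \<longleftrightarrow> A \<in> V \<and> finitely_generated A \<and> subdirectly_irreducible A \<and>
     completely_join_prime (subvarieties V) (generated_variety A)"


section \<open>Varieties form a complete lattice\<close>

lemma variety_Inter:
  assumes "\<And>V. V \<in> \<V> \<Longrightarrow> variety V" and "\<V> \<noteq> {}"
  shows "variety (\<Inter>\<V>)"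
proof -
  obtain E where E: "\<And>V. V \<in> \<V> \<Longrightarrow> V = models (E V)"
    using assms(1) unfolding variety_def by metis
  have "A \<in> \<Inter>\<V> \<longleftrightarrow> A \<in> models (\<Union>V\<in>\<V>. E V)" for A
  proof -
    have "A \<in> \<Inter>\<V> \<longleftrightarrow> (\<forall>V\<in>\<V>. A \<in> models (E V))"
      using E by blast
    also have "\<dots> \<longleftrightarrow> A \<in> models (\<Union>V\<in>\<V>. E V)"
      using assms(2) unfolding models_def by blast
    finally show ?thesis .
  qed
  then show ?thesis
    unfolding variety_def by blast
qed

lemma variety_CIRL: "variety (CIRL :: 'u::infinite rlat set)"
proof -
  let ?c = "(Mult (Var 0) (Var 1), Mult (Var 1) (Var 0))"
  let ?i = "(Meet (Var 0) One, Var 0)"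
  have c: "satisfies A ?c \<longleftrightarrow> commutative A" for A :: "'u rlat"
  proof
    assume s: "satisfies A ?c"
    show "commutative A"
      unfolding commutative_def
    proof (intro ballI)
      fix x y assume "x \<in> carrier A" "y \<in> carrier A"
      then have "(\<lambda>n. if n = 0 then x else y) \<in> UNIV \<rightarrow> carrier A"
        by auto
      then show "x \<otimes>\<^bsub>A\<^esub> y = y \<otimes>\<^bsub>A\<^esub> x"
        using s by (fastforce simp: satisfies_def)
    qed
  qed (auto simp: satisfies_def commutative_def)
  have i: "satisfies A ?i \<longleftrightarrow> integral A" for A :: "'u rlat"
  proof
    assume s: "satisfies A ?i"
    show "integral A"
      unfolding integral_def
    proof
      fix x assume "x \<in> carrier A"
      then have "(\<lambda>n. x) \<in> UNIV \<rightarrow> carrier A"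
        by auto
      then show "x \<preceq>\<^bsub>A\<^esub> \<one>\<^bsub>A\<^esub>"
        using s by (fastforce simp: satisfies_def rl_le_def)
    qed
  qed (auto simp: satisfies_def integral_def rl_le_def)
  have "CIRL = (models {?c, ?i} :: 'u rlat set)"
    unfolding CIRL_def models_def using c i by auto
  then show ?thesis
    unfolding variety_def by blast
qed

lemma complete_lattice_subvarieties:
  assumes "variety V"
  shows "complete_lattice (subvarieties V)"
proof -
  let ?L = "subvarieties V"
  interpret partial_order ?L
    by standard (auto simp: subvarieties_def)
  show ?thesis
  proof (rule complete_lattice_criterion1)
    show "\<exists>g. greatest ?L g (carrier ?L)"
      using assms by (intro exI[of _ V]) (auto simp: greatest_def subvarieties_def)
  next
    fix S assume S: "S \<subseteq> carrier ?L" "S \<noteq> {}"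
    then have "variety (\<Inter>S)" and mem: "\<And>W. W \<in> S \<Longrightarrow> variety W \<and> W \<subseteq> V"
      by (auto intro!: variety_Inter simp: subvarieties_def)
    moreover from mem S(2) have "\<Inter>S \<subseteq> V"
      by blast
    moreover have "W \<subseteq> \<Inter>S" if "W \<in> Lower ?L S" for W
      using that mem by (fastforce simp: Lower_def subvarieties_def)
    ultimately show "\<exists>i. greatest ?L i (Lower ?L S)"
      by (intro exI[of _ "\<Inter>S"]) (auto simp: greatest_def Lower_def subvarieties_def)
  qed
qed

end

(* To show that a variety c of commutative integral residuated lattices lies below no single
   member of a family of varieties, but below their join, it suffices that the family generates
   CIRL and that each member satisfies an identity failing in c.

   From an algebra A in CIRL, form the ideals of the graded monoid of all pairs (c, n) with n > 0,
   together with a unit of degree 0, that contain all elements of sufficiently large degree.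
   Evaluating a term in this algebra at the ideals generated in degree 1 by elements of A yields,
   in degrees away from 0 and from a large cut-off k, the principal ideals of the value of the
   term in A, so every identity failing in A also fails there. If the cut-off is at degree k, the
   algebra satisfies x^k = x^(k+1); if it is k degrees above the lowest degree present in the
   ideal, then it satisfies (x \<rightarrow> x^2)^(k+1) \<le> x, and then x^n = x^(n+1) forces x = 1. Hence both kinds
   of identity give families generating CIRL, and no nontrivial algebra satisfies one of each.
   For finite algebras the first identity is automatic. *)
theory Submission
  imports Defs "HOL-Library.Countable_Set"
begin

section \<open>Commutative integral residuated lattices\<close>

context residuated_lattice
begin

lemma meet_idem: "x \<in> carrier A \<Longrightarrow> x \<curlywedge> x = x"
  by (metis join_absorb meet_absorb meet_closed)

lemma le_refl: "x \<in> carrier A \<Longrightarrow> x \<preceq> x"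
  by (simp add: rl_le_def meet_idem)

lemma le_antisym: "\<lbrakk>x \<preceq> y; y \<preceq> x; x \<in> carrier A; y \<in> carrier A\<rbrakk> \<Longrightarrow> x = y"
  by (metis meet_comm rl_le_def)

lemma le_trans:
  "\<lbrakk>x \<preceq> y; y \<preceq> z; x \<in> carrier A; y \<in> carrier A; z \<in> carrier A\<rbrakk> \<Longrightarrow> x \<preceq> z"
  by (metis meet_assoc rl_le_def)

lemma le_meet_iff:
  "\<lbrakk>x \<in> carrier A; y \<in> carrier A; z \<in> carrier A\<rbrakk> \<Longrightarrow> z \<preceq> x \<curlywedge> y \<longleftrightarrow> z \<preceq> x \<and> z \<preceq> y"
  unfolding rl_le_def by (metis meet_assoc meet_closed meet_comm meet_idem)

lemma le_iff_join: "\<lbrakk>x \<in> carrier A; y \<in> carrier A\<rbrakk> \<Longrightarrow> x \<preceq> y \<longleftrightarrow> x \<curlyvee> y = y"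
  unfolding rl_le_def by (metis join_absorb join_comm meet_absorb meet_comm)

lemma join_le_iff:
  "\<lbrakk>x \<in> carrier A; y \<in> carrier A; z \<in> carrier A\<rbrakk> \<Longrightarrow> x \<curlyvee> y \<preceq> z \<longleftrightarrow> x \<preceq> z \<and> y \<preceq> z"
  by (metis (no_types) join_assoc join_closed join_comm le_iff_join meet_absorb rl_le_def)

lemma join_upper:
  assumes "x \<in> carrier A" "y \<in> carrier A"
  shows "x \<preceq> x \<curlyvee> y" "y \<preceq> x \<curlyvee> y"
  using assms join_le_iff[of x y "x \<curlyvee> y"] by (simp_all add: le_refl)

end

section \<open>Consequences of commutativity and integrality\<close>

locale cirl = residuated_lattice +
  assumes mult_comm: "\<lbrakk>x \<in> carrier A; y \<in> carrier A\<rbrakk> \<Longrightarrow> x \<otimes> y = y \<otimes> x"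
    and le_one: "x \<in> carrier A \<Longrightarrow> x \<preceq> \<one>"
begin

sublocale comm_monoid A
  by unfold_locales (rule mult_comm)

lemma rdiv_eq_ldiv:
  assumes "x \<in> carrier A" "y \<in> carrier A"
  shows "y \<div> x = x \<setminus> y"
proof (rule le_antisym)
  have *: "z \<preceq> x \<setminus> y \<longleftrightarrow> z \<preceq> y \<div> x" if "z \<in> carrier A" for z
    using that assms by (simp add: ldiv_residual flip: rdiv_residual mult_comm[of z])
  show "y \<div> x \<preceq> x \<setminus> y" "x \<setminus> y \<preceq> y \<div> x"
    using assms *[of "x \<setminus> y"] *[of "y \<div> x"] by (simp_all add: le_refl)
qed (use assms in auto)

lemma mult_mono:
  assumes "x \<preceq> x'" "y \<preceq> y'" "x \<in> carrier A" "x' \<in> carrier A" "y \<in> carrier A" "y' \<in> carrier A"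
  shows "x \<otimes> y \<preceq> x' \<otimes> y'"
proof -
  have right: "u \<otimes> v \<preceq> u \<otimes> w"
    if "v \<preceq> w" "u \<in> carrier A" "v \<in> carrier A" "w \<in> carrier A" for u v w
  proof -
    have "w \<preceq> u \<setminus> (u \<otimes> w)"
      using that by (simp add: ldiv_residual le_refl)
    then have "v \<preceq> u \<setminus> (u \<otimes> w)"
      using that le_trans[of v w] by simp
    then show ?thesis
      using that by (simp add: ldiv_residual)
  qed
  show ?thesis
    using right[of y y' x] right[of x x' y'] assms le_trans[of "x \<otimes> y" "x \<otimes> y'" "x' \<otimes> y'"]
    by (simp add: mult_comm[of y'])
qed

lemma mult_le:
  assumes "x \<in> carrier A" "y \<in> carrier A"
  shows "x \<otimes> y \<preceq> x" "x \<otimes> y \<preceq> y"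
  using mult_mono[OF le_refl le_one, of x y] mult_mono[OF le_one le_refl, of x y] assms by auto

text \<open>Multiplication by \<open>x\<close> is a lower adjoint, hence preserves joins. Only this
  half is needed later, to see that residuals of graded ideals are closed under joins.\<close>

lemma mult_join_le:
  assumes "x \<otimes> y \<preceq> z" "x \<otimes> y' \<preceq> z"
    and "x \<in> carrier A" "y \<in> carrier A" "y' \<in> carrier A" "z \<in> carrier A"
  shows "x \<otimes> (y \<curlyvee> y') \<preceq> z"
  using assms by (simp flip: ldiv_residual add: join_le_iff)

lemma eval_closed: "\<rho> \<in> UNIV \<rightarrow> carrier A \<Longrightarrow> eval A \<rho> t \<in> carrier A"
  by (induction t) auto

end

lemma cirl_iff: "cirl A \<longleftrightarrow> residuated_lattice A \<and> commutative A \<and> integral A"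
  by (auto simp: cirl_def cirl_axioms_def commutative_def integral_def)

lemma CIRL_iff_cirl: "A \<in> CIRL \<longleftrightarrow> cirl A"
  by (simp add: CIRL_def cirl_iff)

section \<open>Residuated lattices of closed sets\<close>

text \<open>A general source of algebras in \<open>CIRL\<close>. Closure under residuals by elements
  (\<open>residual_K\<close>) makes \<open>cl\<close> a nucleus on the nonempty subsets of
  \<open>W\<close>, so the closed sets form a residuated lattice; \<open>ideal_K\<close> makes the
  whole of \<open>W\<close> the unit, whence integrality.\<close>

locale closure_frame = comm_monoid W for W (structure) +
  fixes K :: "'a set set"
  assumes K_subset: "P \<in> K \<Longrightarrow> P \<subseteq> carrier W"
    and K_nonempty: "P \<in> K \<Longrightarrow> P \<noteq> {}"
    and carrier_K: "carrier W \<in> K"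
    and Inter_K: "\<lbrakk>S \<subseteq> K; S \<noteq> {}; \<Inter>S \<noteq> {}\<rbrakk> \<Longrightarrow> \<Inter>S \<in> K"
    and ideal_K: "\<lbrakk>P \<in> K; x \<in> P; w \<in> carrier W\<rbrakk> \<Longrightarrow> x \<otimes> w \<in> P"
    and residual_K: "\<lbrakk>P \<in> K; w \<in> carrier W\<rbrakk> \<Longrightarrow> {v \<in> carrier W. w \<otimes> v \<in> P} \<in> K"
begin

definition cl :: "'a set \<Rightarrow> 'a set" where
  "cl U = \<Inter>{P \<in> K. U \<subseteq> P}"

definition product :: "'a set \<Rightarrow> 'a set \<Rightarrow> 'a set" where
  "product P Q = cl {x \<otimes> y | x y. x \<in> P \<and> y \<in> Q}"

definition residual :: "'a set \<Rightarrow> 'a set \<Rightarrow> 'a set" where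
  "residual P Z = {w \<in> carrier W. \<forall>x\<in>P. x \<otimes> w \<in> Z}"

definition algebra :: "'a set rlat" where
  "algebra = \<lparr>carrier = K, monoid.mult = product, one = carrier W, rl_meet = (\<inter>),
     rl_join = (\<lambda>P Q. cl (P \<union> Q)), ldiv = residual, rdiv = (\<lambda>Z Q. residual Q Z)\<rparr>"

lemma algebra_simps_rl [simp]:
  "carrier algebra = K" "P \<otimes>\<^bsub>algebra\<^esub> Q = product P Q" "\<one>\<^bsub>algebra\<^esub> = carrier W"
  "P \<curlywedge>\<^bsub>algebra\<^esub> Q = P \<inter> Q" "P \<curlyvee>\<^bsub>algebra\<^esub> Q = cl (P \<union> Q)"
  "P \<setminus>\<^bsub>algebra\<^esub> Q = residual P Q" "P \<div>\<^bsub>algebra\<^esub> Q = residual Q P"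
  "P \<preceq>\<^bsub>algebra\<^esub> Q \<longleftrightarrow> P \<subseteq> Q"
  by (auto simp: algebra_def rl_le_def)

lemma cl_closed:
  assumes "U \<noteq> {}" "U \<subseteq> carrier W"
  shows "cl U \<in> K"
  unfolding cl_def
proof (rule Inter_K)
  show "\<Inter>{P \<in> K. U \<subseteq> P} \<noteq> {}"
    using assms(1) by auto
qed (use assms(2) carrier_K in auto)

lemma cl_subset_iff: "Z \<in> K \<Longrightarrow> cl U \<subseteq> Z \<longleftrightarrow> U \<subseteq> Z"
  unfolding cl_def by blast

lemma cl_upper: "U \<subseteq> cl U"
  unfolding cl_def by blast

text \<open>The product of an element of \<open>P\<close> and an element of \<open>Q\<close> lies in
  both ideals, so the intersection is nonempty and \<open>Inter_K\<close> applies.\<close>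

lemma Int_closed:
  assumes "P \<in> K" "Q \<in> K"
  shows "P \<inter> Q \<in> K"
proof -
  obtain x y where "x \<in> P" "y \<in> Q"
    using assms K_nonempty by blast
  moreover from this have "x \<in> carrier W" "y \<in> carrier W"
    using assms K_subset by blast+
  ultimately have "x \<otimes> y \<in> P \<inter> Q"
    using assms ideal_K[of P x y] ideal_K[of Q y x] by (simp add: m_comm)
  then show ?thesis
    using Inter_K[of "{P, Q}"] assms by auto
qed

lemma products_subset:
  assumes "P \<in> K" "Q \<in> K"
  shows "{x \<otimes> y | x y. x \<in> P \<and> y \<in> Q} \<subseteq> carrier W"
  using K_subset[OF assms(1)] K_subset[OF assms(2)] by auto

lemma product_closed:
  assumes "P \<in> K" "Q \<in> K"
  shows "product P Q \<in> K"
  unfolding product_def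
proof (rule cl_closed)
  show "{x \<otimes> y | x y. x \<in> P \<and> y \<in> Q} \<noteq> {}"
    using K_nonempty[OF assms(1)] K_nonempty[OF assms(2)] by auto
qed (rule products_subset[OF assms])

lemma residual_closed:
  assumes "P \<in> K" "Z \<in> K"
  shows "residual P Z \<in> K"
proof -
  let ?S = "(\<lambda>x. {v \<in> carrier W. x \<otimes> v \<in> Z}) ` P"
  have eq: "residual P Z = \<Inter>?S"
    using K_nonempty[OF assms(1)] by (auto simp: residual_def)
  \<comment> \<open>\<open>Inter_K\<close> asks for a nonempty intersection; as \<open>Z\<close> is
    an ideal, each of its elements lies in the residual.\<close>
  obtain z where z: "z \<in> Z"
    using assms K_nonempty by blast
  then have "z \<in> residual P Z"
    using ideal_K[OF assms(2) z] K_subset[OF assms(2)] K_subset[OF assms(1)]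
    by (auto simp: residual_def subset_eq m_comm)
  then have "\<Inter>?S \<noteq> {}"
    using eq by blast
  then show ?thesis
    unfolding eq
  proof (rule Inter_K[rotated 2])
    show "?S \<subseteq> K" "?S \<noteq> {}"
      using K_subset[OF assms(1)] K_nonempty[OF assms(1)] residual_K[OF assms(2)] by auto
  qed
qed

lemma product_subset_iff:
  "Z \<in> K \<Longrightarrow> product P Q \<subseteq> Z \<longleftrightarrow> (\<forall>x\<in>P. \<forall>y\<in>Q. x \<otimes> y \<in> Z)"
  unfolding product_def by (subst cl_subset_iff) auto

lemma product_upper: "\<lbrakk>x \<in> P; y \<in> Q\<rbrakk> \<Longrightarrow> x \<otimes> y \<in> product P Q"
  unfolding product_def by (rule subsetD[OF cl_upper]) blast

lemma subset_residual_iff: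
  "\<lbrakk>Q \<in> K; Z \<in> K\<rbrakk> \<Longrightarrow> Q \<subseteq> residual P Z \<longleftrightarrow> product P Q \<subseteq> Z"
  by (subst product_subset_iff) (use K_subset in \<open>auto simp: residual_def\<close>)

lemma product_comm:
  assumes "P \<in> K" "Q \<in> K"
  shows "product P Q = product Q P"
proof -
  have "product P' Q' \<subseteq> product Q' P'" if "P' \<in> K" "Q' \<in> K" for P' Q'
    unfolding product_subset_iff[OF product_closed[OF that(2,1)]]
  proof (intro ballI)
    fix x y assume "x \<in> P'" "y \<in> Q'"
    moreover from this have "x \<otimes> y = y \<otimes> x"
      using that K_subset m_comm by blast
    ultimately show "x \<otimes> y \<in> product Q' P'"
      by (simp add: product_upper)
  qed
  then show ?thesis
    using assms by blast
qed

text \<open>The two sides have the same closed upper bounds: a closed \<open>T\<close> contains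
  either one iff it contains all triple products. Residuation moves one factor to the right, so that
  no closure has to be computed.\<close>

lemma product_assoc:
  assumes "P \<in> K" "Q \<in> K" "Z \<in> K"
  shows "product (product P Q) Z = product P (product Q Z)"
proof -
  have c: "x \<in> carrier W" "y \<in> carrier W" "z \<in> carrier W" if "x \<in> P" "y \<in> Q" "z \<in> Z" for x y z
    using that assms K_subset by blast+
  have left: "product (product P Q) Z \<subseteq> T \<longleftrightarrow> (\<forall>x\<in>P. \<forall>y\<in>Q. \<forall>z\<in>Z. x \<otimes> y \<otimes> z \<in> T)" if "T \<in> K" for T
  proof -
    have "product (product P Q) Z \<subseteq> T \<longleftrightarrow> product P Q \<subseteq> residual Z T"
      using assms that by (simp add: product_comm[of _ Z] subset_residual_iff product_closed)
    also have "\<dots> \<longleftrightarrow> (\<forall>x\<in>P. \<forall>y\<in>Q. \<forall>z\<in>Z. z \<otimes> (x \<otimes> y) \<in> T)"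
      using product_subset_iff[OF residual_closed[OF assms(3) that], of P Q] c
        K_nonempty[OF assms(3)]
      by (auto simp: residual_def)
    finally show ?thesis
      using c by (simp add: m_comm[of "_ \<otimes> _"])
  qed
  have right: "product P (product Q Z) \<subseteq> T \<longleftrightarrow> (\<forall>x\<in>P. \<forall>y\<in>Q. \<forall>z\<in>Z. x \<otimes> y \<otimes> z \<in> T)"
    if "T \<in> K" for T
  proof -
    have "product P (product Q Z) \<subseteq> T \<longleftrightarrow> product Q Z \<subseteq> residual P T"
      using assms that by (simp add: subset_residual_iff product_closed)
    also have "\<dots> \<longleftrightarrow> (\<forall>x\<in>P. \<forall>y\<in>Q. \<forall>z\<in>Z. x \<otimes> (y \<otimes> z) \<in> T)"
      using product_subset_iff[OF residual_closed[OF assms(1) that], of Q Z] c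
        K_nonempty[OF assms(1)]
      by (auto simp: residual_def)
    finally show ?thesis
      using c by (simp add: m_assoc)
  qed
  have closed: "product (product P Q) Z \<in> K" "product P (product Q Z) \<in> K"
    using assms by (simp_all add: product_closed)
  show ?thesis
    using left[OF closed(1)] left[OF closed(2)] right[OF closed(1)] right[OF closed(2)]
    by (intro equalityI) blast+
qed

lemma product_one:
  assumes "P \<in> K"
  shows "product (carrier W) P = P"
proof
  show "product (carrier W) P \<subseteq> P"
    using ideal_K[OF assms] subsetD[OF K_subset[OF assms]]
    by (subst product_subset_iff[OF assms]) (metis m_comm)
  show "P \<subseteq> product (carrier W) P"
    using product_upper[of \<one> "carrier W" _ P] K_subset[OF assms] by (auto simp: subset_eq)
qed

lemma Un_closed: "\<lbrakk>P \<in> K; Q \<in> K\<rbrakk> \<Longrightarrow> cl (P \<union> Q) \<in> K"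
  using K_subset K_nonempty by (intro cl_closed) auto

lemma cl_eq: "P \<in> K \<Longrightarrow> cl P = P"
  using cl_subset_iff[of P P] cl_upper[of P] by blast

lemma cirl_algebra: "cirl algebra"
proof
  fix P Q Z assume K: "P \<in> carrier algebra" "Q \<in> carrier algebra" "Z \<in> carrier algebra"
  then have "P \<in> K" "Q \<in> K" "Z \<in> K" by auto
  then have "cl (cl (P \<union> Q) \<union> Z) \<subseteq> T \<longleftrightarrow> cl (P \<union> cl (Q \<union> Z)) \<subseteq> T" if "T \<in> K" for T
    using that by (auto simp: cl_subset_iff)
  from this[of "cl (cl (P \<union> Q) \<union> Z)"] this[of "cl (P \<union> cl (Q \<union> Z))"]
  show "(P \<curlyvee>\<^bsub>algebra\<^esub> Q) \<curlyvee>\<^bsub>algebra\<^esub> Z = P \<curlyvee>\<^bsub>algebra\<^esub> (Q \<curlyvee>\<^bsub>algebra\<^esub> Z)"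
    using K by (intro equalityI) (simp_all add: Un_closed)
  show "(P \<otimes>\<^bsub>algebra\<^esub> Q) \<otimes>\<^bsub>algebra\<^esub> Z = P \<otimes>\<^bsub>algebra\<^esub> (Q \<otimes>\<^bsub>algebra\<^esub> Z)"
    using K by (simp add: product_assoc)
  show "(Q \<preceq>\<^bsub>algebra\<^esub> P \<setminus>\<^bsub>algebra\<^esub> Z) = (P \<otimes>\<^bsub>algebra\<^esub> Q \<preceq>\<^bsub>algebra\<^esub> Z)"
    using K by (simp add: subset_residual_iff)
  show "(P \<otimes>\<^bsub>algebra\<^esub> Q \<preceq>\<^bsub>algebra\<^esub> Z) = (P \<preceq>\<^bsub>algebra\<^esub> Z \<div>\<^bsub>algebra\<^esub> Q)"
    using K by (simp add: subset_residual_iff product_comm[of P])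
next
  fix P Q assume "P \<in> carrier algebra" "Q \<in> carrier algebra"
  then have K: "P \<in> K" "Q \<in> K" by auto
  show "P \<curlywedge>\<^bsub>algebra\<^esub> (P \<curlyvee>\<^bsub>algebra\<^esub> Q) = P"
    using cl_upper[of "P \<union> Q"] by auto
  show "P \<curlyvee>\<^bsub>algebra\<^esub> (P \<curlywedge>\<^bsub>algebra\<^esub> Q) = P"
    using K by (simp add: cl_eq Un_absorb2)
  show "P \<otimes>\<^bsub>algebra\<^esub> Q = Q \<otimes>\<^bsub>algebra\<^esub> P"
    using K by (simp add: product_comm)
next
  fix P assume "P \<in> carrier algebra"
  then show "\<one>\<^bsub>algebra\<^esub> \<otimes>\<^bsub>algebra\<^esub> P = P" "P \<otimes>\<^bsub>algebra\<^esub> \<one>\<^bsub>algebra\<^esub> = P"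
    "P \<preceq>\<^bsub>algebra\<^esub> \<one>\<^bsub>algebra\<^esub>"
    using K_subset by (simp_all add: product_one product_comm[of P] carrier_K)
qed (simp_all add: product_closed Int_closed residual_closed Un_closed carrier_K Int_ac Un_ac)

end

section \<open>Graded ideals\<close>

text \<open>An ideal with an element of degree \<open>n\<close> has to contain all elements of degree at
  least \<open>g n\<close>. The two instances used are \<open>g n = k + n\<close> and \<open>g n = k\<close>.\<close>

locale graded = cirl +
  fixes k :: nat and g :: "nat \<Rightarrow> nat"
  assumes k_pos: "1 \<le> k"
    and g_mono: "m \<le> n \<Longrightarrow> g m \<le> g n"
    and g_add: "g (m + n) \<le> m + g n"
    and g_lower: "k \<le> g n"
    and g_upper: "g n \<le> k + n"
begin

text \<open>Degree 0 contains only the unit, so a proper ideal lives in positive degrees and its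
  powers move up to the cut-off.\<close>

definition W :: "('a \<times> nat) monoid" where
  "W = \<lparr>carrier = {(c, n). c \<in> carrier A \<and> (n = 0 \<longrightarrow> c = \<one>)},
     monoid.mult = (\<lambda>(c, m) (d, n). (c \<otimes> d, m + n)), one = (\<one>, 0)\<rparr>"

text \<open>Joins are taken degree by degree, so that a single degree can look like a principal
  ideal of \<open>A\<close>. The empty set is excluded: it would be an idempotent bottom element and
  violate the square law. Nonemptiness also lets the cut-off put all large degrees into every closed
  set.\<close>

definition closed :: "('a \<times> nat) set \<Rightarrow> bool" where
  "closed P \<longleftrightarrow> P \<subseteq> carrier W \<and> P \<noteq> {} \<and>
     (\<forall>c n d m. (c, n) \<in> P \<and> (d, m) \<in> carrier W \<and> d \<preceq> c \<and> n \<le> m \<longrightarrow> (d, m) \<in> P) \<and>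
     (\<forall>c d n. (c, n) \<in> P \<and> (d, n) \<in> P \<longrightarrow> (c \<curlyvee> d, n) \<in> P) \<and>
     (\<forall>c n d m. (c, n) \<in> P \<and> (d, m) \<in> carrier W \<and> g n \<le> m \<longrightarrow> (d, m) \<in> P)"

section \<open>The closed sets of graded pairs form a closure frame\<close>

lemma W_simps [simp]:
  "(c, n) \<in> carrier W \<longleftrightarrow> c \<in> carrier A \<and> (n = 0 \<longrightarrow> c = \<one>)"
  "(c, m) \<otimes>\<^bsub>W\<^esub> (d, n) = (c \<otimes> d, m + n)"
  "\<one>\<^bsub>W\<^esub> = (\<one>, 0)"
  by (auto simp: W_def)

lemma closed_in:
  assumes "closed P" "(c, n) \<in> P"
  shows "c \<in> carrier A" "n = 0 \<Longrightarrow> c = \<one>"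
proof -
  have "(c, n) \<in> carrier W"
    using assms unfolding closed_def by blast
  then show "c \<in> carrier A" "n = 0 \<Longrightarrow> c = \<one>"
    by simp_all
qed

lemma closed_nonempty: "closed P \<Longrightarrow> P \<noteq> {}"
  unfolding closed_def by blast

lemma closed_down:
  assumes "closed P" "(c, n) \<in> P" "d \<preceq> c" "n \<le> m" "d \<in> carrier A" "m = 0 \<Longrightarrow> d = \<one>"
  shows "(d, m) \<in> P"
proof -
  have "(d, m) \<in> carrier W"
    using assms by simp
  then show ?thesis
    using assms(1-4) unfolding closed_def by blast
qed

lemma closed_join: "\<lbrakk>closed P; (c, n) \<in> P; (d, n) \<in> P\<rbrakk> \<Longrightarrow> (c \<curlyvee> d, n) \<in> P"
  unfolding closed_def by blast

lemma closed_cut: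
  assumes "closed P" "(c, n) \<in> P" "g n \<le> m" "d \<in> carrier A"
  shows "(d, m) \<in> P"
proof -
  \<comment> \<open>Degrees beyond a cut-off are at least \<open>k\<close>, hence positive, so
    \<open>d\<close> need not be the unit.\<close>
  have "(d, m) \<in> carrier W"
    using assms g_lower[of n] k_pos by simp
  then show ?thesis
    using assms(1-3) unfolding closed_def by blast
qed

sublocale comm_monoid W
  by unfold_locales (auto simp: m_ac)

text \<open>Multiplication by \<open>(a, q)\<close> is monotone, preserves joins and shifts degrees
  by \<open>q\<close>. The residual contains \<open>P\<close> by integrality, so it is
  nonempty.\<close>

lemma closed_residual:
  assumes "closed P" "w \<in> carrier W"
  shows "closed {v \<in> carrier W. w \<otimes>\<^bsub>W\<^esub> v \<in> P}" (is "closed ?R")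
proof -
  obtain a q where w: "w = (a, q)" by fastforce
  have a: "a \<in> carrier A" "q = 0 \<Longrightarrow> a = \<one>"
    using assms w by auto
  have mem: "(c, n) \<in> ?R \<longleftrightarrow> (c, n) \<in> carrier W \<and> (a \<otimes> c, q + n) \<in> P" for c n
    by (simp add: w)
  obtain c n where cn: "(c, n) \<in> P"
    using closed_nonempty[OF assms(1)] by fastforce
  have "(a \<otimes> c, q + n) \<in> P"
    using closed_down[OF assms(1) cn mult_le(2)[of a c]] closed_in[OF assms(1) cn] a by simp
  then have "(c, n) \<in> ?R"
    using closed_in[OF assms(1) cn] by (simp add: w)
  moreover have "(d, m) \<in> ?R" if "(c, n) \<in> ?R" "(d, m) \<in> carrier W" "d \<preceq> c" "n \<le> m" for c n d m
  proof -
    have "a \<otimes> d \<preceq> a \<otimes> c"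
      using that a by (intro mult_mono le_refl) auto
    then show ?thesis
      using that a closed_down[OF assms(1), of "a \<otimes> c" "q + n" "a \<otimes> d" "q + m"]
      unfolding mem by auto
  qed
  moreover have "(c \<curlyvee> d, n) \<in> ?R" if "(c, n) \<in> ?R" "(d, n) \<in> ?R" for c d n
  proof -
    have c: "c \<in> carrier A" "d \<in> carrier A"
      using that by auto
    have "a \<otimes> (c \<curlyvee> d) \<preceq> (a \<otimes> c) \<curlyvee> (a \<otimes> d)"
      using c a by (simp add: mult_join_le join_upper)
    moreover have "((a \<otimes> c) \<curlyvee> (a \<otimes> d), q + n) \<in> P"
      using that closed_join[OF assms(1)] unfolding mem by simp
    \<comment> \<open>In degree 0 both elements are the unit, and so is their join.\<close>
    moreover have top: "n = 0 \<Longrightarrow> c \<curlyvee> d = \<one>"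
      using that le_iff_join[of \<one> \<one>] by (simp add: le_refl)
    ultimately show ?thesis
      using closed_down[OF assms(1), of "(a \<otimes> c) \<curlyvee> (a \<otimes> d)" "q + n" "a \<otimes> (c \<curlyvee> d)" "q + n"] a c
      unfolding mem by simp
  qed
  moreover have "(d, m) \<in> ?R" if "(c, n) \<in> ?R" "(d, m) \<in> carrier W" "g n \<le> m" for c n d m
  proof -
    \<comment> \<open>Shifting degrees by \<open>q\<close> raises the cut-off by at most
      \<open>q\<close>; this is the purpose of \<open>g_add\<close>.\<close>
    have "g (q + n) \<le> q + m"
      using g_add[of q n] that(3) by simp
    then show ?thesis
      using that a closed_cut[OF assms(1), of "a \<otimes> c" "q + n" "q + m" "a \<otimes> d"]
      unfolding mem by auto
  qed
  ultimately show ?thesis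
    unfolding closed_def by blast
qed

lemma closed_carrier: "closed (carrier W)"
  unfolding closed_def
proof (intro conjI allI impI)
  show "carrier W \<noteq> {}"
    using W_simps(1)[of \<one> 0] by blast
next
  fix c d n assume "(c, n) \<in> carrier W \<and> (d, n) \<in> carrier W"
  then show "(c \<curlyvee> d, n) \<in> carrier W"
    using le_iff_join[of \<one> \<one>] by (auto simp: le_refl)
qed auto

lemma closed_Inter:
  assumes "\<And>P. P \<in> S \<Longrightarrow> closed P" "S \<noteq> {}" "\<Inter>S \<noteq> {}"
  shows "closed (\<Inter>S)"
  unfolding closed_def
proof (intro conjI allI impI)
  show "\<Inter>S \<subseteq> carrier W"
    using assms(1,2) unfolding closed_def by blast
next
  fix c n d m assume *: "(c, n) \<in> \<Inter>S \<and> (d, m) \<in> carrier W \<and> d \<preceq> c \<and> n \<le> m"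
  show "(d, m) \<in> \<Inter>S"
  proof
    fix P assume "P \<in> S"
    then show "(d, m) \<in> P"
      using * closed_down[OF assms(1), of P c n d m] by simp
  qed
next
  fix c d n assume *: "(c, n) \<in> \<Inter>S \<and> (d, n) \<in> \<Inter>S"
  show "(c \<curlyvee> d, n) \<in> \<Inter>S"
  proof
    fix P assume "P \<in> S"
    then show "(c \<curlyvee> d, n) \<in> P"
      using * closed_join[OF assms(1), of P c n d] by simp
  qed
next
  fix c n d m assume *: "(c, n) \<in> \<Inter>S \<and> (d, m) \<in> carrier W \<and> g n \<le> m"
  show "(d, m) \<in> \<Inter>S"
  proof
    fix P assume "P \<in> S"
    then show "(d, m) \<in> P"
      using * closed_cut[OF assms(1), of P c n m d] by simp
  qed
qed (rule assms(3))

sublocale frame: closure_frame W "Collect closed"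
proof unfold_locales
  fix P x w assume P: "P \<in> Collect closed" "x \<in> P" "w \<in> carrier W"
  obtain c n d m where xw: "x = (c, n)" "w = (d, m)" by fastforce
  have "(c, n) \<in> P" "closed P" using P xw by auto
  note * = this closed_in[OF this(2,1)]
  show "x \<otimes>\<^bsub>W\<^esub> w \<in> P"
    using closed_down[OF *(2,1) mult_le(1)[of c d], of "n + m"] * P xw by auto
next
  fix P assume "P \<in> Collect closed"
  then show "P \<subseteq> carrier W" "P \<noteq> {}"
    using closed_nonempty unfolding closed_def by blast+
next
  fix S assume "S \<subseteq> Collect closed" "S \<noteq> {}" "\<Inter>S \<noteq> {}"
  then show "\<Inter>S \<in> Collect closed"
    using closed_Inter[of S] by blast
qed (simp_all add: closed_residual closed_carrier)

text \<open>For \<open>r = g 1\<close> this is the closed set generated by \<open>(u, 1)\<close>.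
  Smaller values of \<open>r\<close> give larger closed sets, used as upper bounds.\<close>

definition ideal :: "'a \<Rightarrow> nat \<Rightarrow> ('a \<times> nat) set" where
  "ideal u r = {(e, n). e \<in> carrier A \<and> 1 \<le> n \<and> (e \<preceq> u \<or> r \<le> n)}"

lemma closed_ideal:
  assumes u: "u \<in> carrier A" and r: "r \<le> g 1"
  shows "closed (ideal u r)"
  unfolding closed_def
proof (intro conjI allI impI)
  show "ideal u r \<noteq> {}"
    using u le_refl[of u] by (auto simp: ideal_def)
  fix c n d m assume "(c, n) \<in> ideal u r \<and> (d, m) \<in> carrier W \<and> g n \<le> m"
  then show "(d, m) \<in> ideal u r"
    using r g_mono[of 1 n] g_lower[of n] k_pos by (auto simp: ideal_def)
next
  fix c n d m assume "(c, n) \<in> ideal u r \<and> (d, m) \<in> carrier W \<and> d \<preceq> c \<and> n \<le> m"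
  then show "(d, m) \<in> ideal u r"
    using u le_trans[of d c u] by (auto simp: ideal_def)
qed (auto simp: ideal_def join_le_iff u)

definition tail :: "nat \<Rightarrow> ('a \<times> nat) set" where
  "tail j = {(e, n). e \<in> carrier A \<and> j \<le> n}"

text \<open>The second assumption holds for every \<open>j\<close> if \<open>g n = k + n\<close>,
  but only for \<open>j <= k\<close> if \<open>g\<close> is constantly \<open>k\<close>.\<close>

lemma closed_tail:
  assumes "1 \<le> j" "\<And>n. j \<le> n \<Longrightarrow> j \<le> g n"
  shows "closed (tail j)"
  unfolding closed_def
proof (intro conjI allI impI)
  have "(\<one>, j) \<in> tail j"
    by (simp add: tail_def)
  then show "tail j \<noteq> {}"
    by blast
  fix c n d m assume *: "(c, n) \<in> tail j \<and> (d, m) \<in> carrier W \<and> g n \<le> m"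
  then have "j \<le> g n"
    using assms(2) by (simp add: tail_def)
  with * show "(d, m) \<in> tail j"
    by (simp add: tail_def)
qed (use assms(1) in \<open>auto simp: tail_def\<close>)

end
section \<open>Failing identities survive in algebras of graded ideals\<close>

text \<open>The number of degrees given up at both ends, near 0 and near \<open>k\<close>, when a
  term is evaluated. The sum is a common margin for both arguments; products and residuals double
  it.\<close>

primrec radius :: "rl_term \<Rightarrow> nat" where
  "radius (Var n) = 1"
| "radius One = 1"
| "radius (Mult s t) = 2 * (radius s + radius t)"
| "radius (Meet s t) = 2 * (radius s + radius t)"
| "radius (Join s t) = 2 * (radius s + radius t)"
| "radius (LDiv s t) = 2 * (radius s + radius t)"
| "radius (RDiv s t) = 2 * (radius s + radius t)"

lemma radius_pos: "1 \<le> radius t"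
  by (induction t) auto

section \<open>Closed sets that agree with a principal ideal in the middle degrees\<close>

context graded
begin

definition approximates :: "nat \<Rightarrow> ('a \<times> nat) set \<Rightarrow> 'a \<Rightarrow> bool" where
  "approximates b P c \<longleftrightarrow> closed P \<and> c \<in> carrier A \<and> 1 \<le> b \<and>
     (\<forall>p d. b \<le> p \<and> p + b \<le> k \<and> d \<in> carrier A \<longrightarrow> ((d, p) \<in> P \<longleftrightarrow> d \<preceq> c))"

lemma approximatesI:
  assumes "closed P" "c \<in> carrier A" "1 \<le> b"
    and "\<And>p d. \<lbrakk>b \<le> p; p + b \<le> k; d \<in> carrier A; (d, p) \<in> P\<rbrakk> \<Longrightarrow> d \<preceq> c"
    and "\<And>p. \<lbrakk>b \<le> p; p + b \<le> k\<rbrakk> \<Longrightarrow> (c, p) \<in> P"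
  shows "approximates b P c"
proof -
  have "(d, p) \<in> P" if "b \<le> p" "p + b \<le> k" "d \<in> carrier A" "d \<preceq> c" for p d
    using closed_down[OF assms(1) assms(5)[OF that(1,2)] that(4), of p] that assms(3) by simp
  then show ?thesis
    unfolding approximates_def using assms by blast
qed

lemma approximatesD:
  assumes "approximates b P c"
  shows "closed P" "c \<in> carrier A" "1 \<le> b"
    and "\<lbrakk>b \<le> p; p + b \<le> k; d \<in> carrier A\<rbrakk> \<Longrightarrow> (d, p) \<in> P \<longleftrightarrow> d \<preceq> c"
  using assms unfolding approximates_def by blast+

lemma approximates_mem: "\<lbrakk>approximates b P c; b \<le> p; p + b \<le> k\<rbrakk> \<Longrightarrow> (c, p) \<in> P"
  using approximatesD by (simp add: le_refl)

text \<open>Low degrees need no margin: closed sets are closed upwards in degree, so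
  \<open>d\<close> reappears in degree \<open>max n b\<close>, which lies in the middle range
  because \<open>2 * b <= k\<close>.\<close>

lemma approximates_le:
  assumes "approximates b P c" "(d, n) \<in> P" "n + b \<le> k" "2 * b \<le> k"
  shows "d \<preceq> c"
proof -
  note P = approximatesD[OF assms(1)]
  have d: "d \<in> carrier A"
    by (rule closed_in(1)[OF P(1) assms(2)])
  have "(d, max n b) \<in> P"
    using closed_down[OF P(1) assms(2) le_refl[OF d], of "max n b"] d P(3) by simp
  then show ?thesis
    using P(4)[of "max n b" d] d assms(3,4) by simp
qed

lemma approximates_weaken: "\<lbrakk>approximates b P c; b \<le> b'\<rbrakk> \<Longrightarrow> approximates b' P c"
  unfolding approximates_def by (auto intro: order.trans)

lemma approximates_ideal:
  assumes "c \<in> carrier A"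
  shows "approximates 1 (ideal c (g 1)) c"
  using assms closed_ideal[OF assms, of "g 1"] g_lower[of 1]
  by (intro approximatesI) (auto simp: ideal_def le_refl)

lemma approximates_carrier: "approximates 1 (carrier W) \<one>"
  by (intro approximatesI closed_carrier) (auto simp: le_one)

lemma approximates_Int:
  assumes "approximates b P c" "approximates b Q d"
  shows "approximates b (P \<inter> Q) (c \<curlywedge> d)"
proof -
  note P = approximatesD[OF assms(1)] and Q = approximatesD[OF assms(2)]
  have "closed (P \<inter> Q)"
    using frame.Int_closed[of P Q] P(1) Q(1) by simp
  then show ?thesis
    unfolding approximates_def using P Q by (auto simp: le_meet_iff)
qed

text \<open>When \<open>u\<close> is not the unit, the closed set \<open>ideal u (k - b + 1)\<close> bounds joins and products
  of ideals from above on the levels up to \<open>k - b\<close>.\<close>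

lemma le_of_closure:
  assumes U: "(e, p) \<in> frame.cl U" "p + b \<le> k" and b: "1 \<le> b"
    and u: "u \<in> carrier A" "e \<in> carrier A"
    and le: "\<And>d n. \<lbrakk>(d, n) \<in> U; n + b \<le> k\<rbrakk> \<Longrightarrow> d \<preceq> u"
    and sub: "U \<subseteq> carrier W"
  shows "e \<preceq> u"
proof (cases "u = \<one>")
  case True
  then show ?thesis
    using u le_one by simp
next
  case False
  \<comment> \<open>\<open>ideal u r\<close> has no elements of degree 0, so it can contain
    \<open>U\<close> only if the unit of \<open>W\<close> is not in \<open>U\<close>.\<close>
  have "(\<one>, 0) \<notin> U"
  proof
    assume "(\<one>, 0) \<in> U"
    then have "\<one> \<preceq> u"
      using le[of \<one> 0] U(2) by simp
    then show False
      using False le_antisym[of u \<one>] le_one u by simp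
  qed
  have "U \<subseteq> ideal u (k - b + 1)"
  proof (rule subrelI)
    fix d n assume dn: "(d, n) \<in> U"
    then have "d \<in> carrier A" "n = 0 \<Longrightarrow> d = \<one>"
      using sub W_simps(1) by blast+
    with dn \<open>(\<one>, 0) \<notin> U\<close> have "1 \<le> n"
      by (cases n) auto
    moreover have "d \<preceq> u \<or> k - b + 1 \<le> n"
      using le[OF dn] \<open>1 \<le> n\<close> by (cases "n + b \<le> k") auto
    ultimately show "(d, n) \<in> ideal u (k - b + 1)"
      using \<open>d \<in> carrier A\<close> by (simp add: ideal_def)
  qed
  \<comment> \<open>As \<open>1 <= b\<close>, the value \<open>k - b + 1\<close> is at most
    \<open>k\<close> and thus at most \<open>g 1\<close>.\<close>
  moreover have "closed (ideal u (k - b + 1))"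
    using u b k_pos g_lower[of 1] by (intro closed_ideal) auto
  ultimately have "frame.cl U \<subseteq> ideal u (k - b + 1)"
    using frame.cl_subset_iff by simp
  then have "(e, p) \<in> ideal u (k - b + 1)"
    using U(1) by blast
  then show ?thesis
    using U(2) by (auto simp: ideal_def)
qed

lemma approximates_cl_Un:
  assumes "approximates b P c" "approximates b Q d" "2 * b \<le> k"
  shows "approximates b (frame.cl (P \<union> Q)) (c \<curlyvee> d)"
proof (rule approximatesI)
  note P = approximatesD[OF assms(1)] and Q = approximatesD[OF assms(2)]
  show cl: "closed (frame.cl (P \<union> Q))"
    using frame.Un_closed[of P Q] P(1) Q(1) by simp
  show "c \<curlyvee> d \<in> carrier A" "1 \<le> b"
    using P Q by simp_all
  show "e \<preceq> c \<curlyvee> d" if "p + b \<le> k" "e \<in> carrier A" "(e, p) \<in> frame.cl (P \<union> Q)" for p e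
  proof (rule le_of_closure[OF that(3,1) P(3)])
    fix x n assume x: "(x, n) \<in> P \<union> Q" "n + b \<le> k"
    then have "x \<in> carrier A"
      using closed_in P(1) Q(1) by auto
    moreover have "x \<preceq> c \<or> x \<preceq> d"
      using x approximates_le[OF assms(1) _ _ assms(3)] approximates_le[OF assms(2) _ _ assms(3)]
      by blast
    ultimately show "x \<preceq> c \<curlyvee> d"
      using P(2) Q(2) join_upper[of c d] le_trans[of x c "c \<curlyvee> d"] le_trans[of x d "c \<curlyvee> d"]
      by auto
  next
    show "P \<union> Q \<subseteq> carrier W"
      using P(1) Q(1) frame.K_subset by simp
  qed (use that P Q in auto)
  show "(c \<curlyvee> d, p) \<in> frame.cl (P \<union> Q)" if "b \<le> p" "p + b \<le> k" for p
    using closed_join[OF cl] frame.cl_upper[of "P \<union> Q"]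
      approximates_mem[OF assms(1) that] approximates_mem[OF assms(2) that] by blast
qed

lemma approximates_product:
  assumes "approximates b P c" "approximates b Q d" "2 * b \<le> k"
  shows "approximates (2 * b) (frame.product P Q) (c \<otimes> d)"
proof (rule approximatesI)
  note P = approximatesD[OF assms(1)] and Q = approximatesD[OF assms(2)]
  let ?U = "{x \<otimes>\<^bsub>W\<^esub> y | x y. x \<in> P \<and> y \<in> Q}"
  show cl: "closed (frame.product P Q)"
    using frame.product_closed[of P Q] P(1) Q(1) by simp
  show "c \<otimes> d \<in> carrier A" "1 \<le> 2 * b"
    using P Q by simp_all
  show "e \<preceq> c \<otimes> d"
    if "p + 2 * b \<le> k" "e \<in> carrier A" "(e, p) \<in> frame.product P Q" for p e
  proof (rule le_of_closure[of e p ?U b])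
    show "(e, p) \<in> frame.cl ?U"
      using that by (simp add: frame.product_def)
    show "x \<preceq> c \<otimes> d" if U: "(x, n) \<in> ?U" "n + b \<le> k" for x n
    proof -
      obtain y i z j where yz: "(y, i) \<in> P" "(z, j) \<in> Q" "x = y \<otimes> z" "n = i + j"
        using U(1) by auto
      \<comment> \<open>Degrees add up, so \<open>i + j <= k - b\<close> bounds both
        \<open>i\<close> and \<open>j\<close> by \<open>k - b\<close>.\<close>
      then have "y \<preceq> c" "z \<preceq> d"
        using approximates_le[OF assms(1) yz(1) _ assms(3)] U(2)
          approximates_le[OF assms(2) yz(2) _ assms(3)] by auto
      then show ?thesis
        using yz P(2) Q(2) closed_in[OF P(1) yz(1)] closed_in[OF Q(1) yz(2)] mult_mono by simp
    qed
    show "?U \<subseteq> carrier W"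
      using frame.products_subset[of P Q] P(1) Q(1) by simp
  qed (use that P Q in auto)
  \<comment> \<open>The degree is split as \<open>p = b + (p - b)\<close>; both parts must be at
    least \<open>b\<close>, which is why the lower margin doubles.\<close>
  show "(c \<otimes> d, p) \<in> frame.product P Q" if "2 * b \<le> p" "p + 2 * b \<le> k" for p
    using frame.product_upper[of "(c, b)" P "(d, p - b)" Q] that assms(3)
      approximates_mem[OF assms(1), of b] approximates_mem[OF assms(2), of "p - b"] by simp
qed

lemma approximates_residual:
  assumes "approximates b P c" "approximates b Q d" "2 * b \<le> k"
  shows "approximates (2 * b) (frame.residual P Q) (c \<setminus> d)"
proof (rule approximatesI)
  note P = approximatesD[OF assms(1)] and Q = approximatesD[OF assms(2)]
  show cl: "closed (frame.residual P Q)"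
    using frame.residual_closed[of P Q] P(1) Q(1) by simp
  show c: "c \<setminus> d \<in> carrier A" "1 \<le> 2 * b"
    using P Q by simp_all
  show "e \<preceq> c \<setminus> d"
    if "p + 2 * b \<le> k" "e \<in> carrier A" "(e, p) \<in> frame.residual P Q" for p e
  proof -
    \<comment> \<open>Testing against \<open>(c, b)\<close> raises the degree by \<open>b\<close>,
      which is why the upper margin doubles.\<close>
    have "(c \<otimes> e, b + p) \<in> Q"
      using that(3) approximates_mem[OF assms(1), of b] assms(3)
      by (fastforce simp: frame.residual_def)
    then have "c \<otimes> e \<preceq> d"
      using approximates_le[OF assms(2) _ _ assms(3)] that by simp
    then show ?thesis
      using P Q that by (simp add: ldiv_residual)
  qed
  show "(c \<setminus> d, p) \<in> frame.residual P Q" if p: "2 * b \<le> p" "p + 2 * b \<le> k" for p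
  proof -
    have "(x \<otimes> (c \<setminus> d), n + p) \<in> Q" if x: "(x, n) \<in> P" for x n
    proof (cases "n + b \<le> k")
      case True
      have xc: "x \<in> carrier A"
        by (rule closed_in(1)[OF P(1) x])
      have "x \<preceq> c"
        using approximates_le[OF assms(1) x True assms(3)] .
      then have "x \<otimes> (c \<setminus> d) \<preceq> c \<otimes> (c \<setminus> d)"
        using xc P(2) c by (intro mult_mono le_refl) auto
      moreover have "c \<otimes> (c \<setminus> d) \<preceq> d"
        using ldiv_residual[of c "c \<setminus> d" d] P(2) Q(2) by (simp add: le_refl)
      ultimately have "x \<otimes> (c \<setminus> d) \<preceq> d"
        using le_trans[of "x \<otimes> (c \<setminus> d)" "c \<otimes> (c \<setminus> d)" d] xc P(2) Q(2) by simp
      \<comment> \<open>The degree \<open>n + p\<close> may exceed the range in which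
        \<open>Q\<close> is known; then \<open>d\<close> is taken in the last such degree
        \<open>k - b\<close> and moved up.\<close>
      moreover have "(d, min (n + p) (k - b)) \<in> Q"
        using approximates_mem[OF assms(2)] p assms(3) by auto
      ultimately show ?thesis
        using closed_down[OF Q(1)] xc c p P(3) by auto
    next
      case False
      \<comment> \<open>Here nothing is known about \<open>x\<close>, but
        \<open>n + p > (k - b) + 2 * b = k + b >= g b\<close>, so the cut-off of \<open>Q\<close> at
        \<open>(d, b)\<close> applies.\<close>
      have "(d, b) \<in> Q"
        using approximates_mem[OF assms(2), of b] assms(3) by simp
      then show ?thesis
        using closed_cut[OF Q(1), of d b "n + p"] g_upper[of b] False p
          closed_in[OF P(1) x] c by simp
    qed
    then show ?thesis
      using c p P(3) by (auto simp: frame.residual_def)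
  qed
qed

lemma approximates_eval:
  assumes \<rho>: "\<rho> \<in> UNIV \<rightarrow> carrier A"
  shows "2 * radius t \<le> k \<Longrightarrow>
    approximates (radius t) (eval frame.algebra (\<lambda>n. ideal (\<rho> n) (g 1)) t) (eval A \<rho> t)"
proof (induction t)
  case (Var n)
  show ?case
    using approximates_ideal[of "\<rho> n"] \<rho> by auto
next
  case One
  show ?case
    using approximates_carrier by simp
next
  case (Mult s t)
  let ?b = "radius s + radius t"
  have "approximates (2 * ?b) (frame.product
      (eval frame.algebra (\<lambda>n. ideal (\<rho> n) (g 1)) s) (eval frame.algebra (\<lambda>n. ideal (\<rho> n) (g 1)) t))
      (eval A \<rho> s \<otimes> eval A \<rho> t)"
    using Mult by (intro approximates_product approximates_weaken[OF Mult.IH(1)]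
        approximates_weaken[OF Mult.IH(2)]) auto
  then show ?case
    by simp
next
  case (Meet s t)
  let ?b = "radius s + radius t"
  have "approximates ?b
      (eval frame.algebra (\<lambda>n. ideal (\<rho> n) (g 1)) s \<inter> eval frame.algebra (\<lambda>n. ideal (\<rho> n) (g 1)) t)
      (eval A \<rho> s \<curlywedge> eval A \<rho> t)"
    using Meet by (intro approximates_Int approximates_weaken[OF Meet.IH(1)]
        approximates_weaken[OF Meet.IH(2)]) auto
  then show ?case
    by (auto intro: approximates_weaken)
next
  case (Join s t)
  let ?b = "radius s + radius t"
  have "approximates ?b (frame.cl
      (eval frame.algebra (\<lambda>n. ideal (\<rho> n) (g 1)) s \<union> eval frame.algebra (\<lambda>n. ideal (\<rho> n) (g 1)) t))
      (eval A \<rho> s \<curlyvee> eval A \<rho> t)"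
    using Join by (intro approximates_cl_Un approximates_weaken[OF Join.IH(1)]
        approximates_weaken[OF Join.IH(2)]) auto
  then show ?case
    by (auto intro: approximates_weaken)
next
  case (LDiv s t)
  let ?b = "radius s + radius t"
  have "approximates (2 * ?b) (frame.residual
      (eval frame.algebra (\<lambda>n. ideal (\<rho> n) (g 1)) s) (eval frame.algebra (\<lambda>n. ideal (\<rho> n) (g 1)) t))
      (eval A \<rho> s \<setminus> eval A \<rho> t)"
    using LDiv by (intro approximates_residual approximates_weaken[OF LDiv.IH(1)]
        approximates_weaken[OF LDiv.IH(2)]) auto
  then show ?case
    by simp
next
  case (RDiv s t)
  let ?b = "radius s + radius t"
  have "approximates (2 * ?b) (frame.residual
      (eval frame.algebra (\<lambda>n. ideal (\<rho> n) (g 1)) t) (eval frame.algebra (\<lambda>n. ideal (\<rho> n) (g 1)) s))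
      (eval A \<rho> t \<setminus> eval A \<rho> s)"
    using RDiv by (intro approximates_residual approximates_weaken[OF RDiv.IH(1)]
        approximates_weaken[OF RDiv.IH(2)]) auto
  then show ?case
    using \<rho> by (simp add: rdiv_eq_ldiv eval_closed)
qed

text \<open>In degree \<open>radius s + radius t\<close>, still in the middle range, the two
  interpretations are the principal ideals of the values in \<open>A\<close>. Equal interpretations
  would give equal values.\<close>

lemma fails_algebra:
  assumes \<rho>: "\<rho> \<in> UNIV \<rightarrow> carrier A" and ne: "eval A \<rho> s \<noteq> eval A \<rho> t"
    and k: "2 * (radius s + radius t) \<le> k"
  shows "\<not> satisfies frame.algebra (s, t)"
proof
  let ?\<sigma> = "\<lambda>n. ideal (\<rho> n) (g 1)" and ?b = "radius s + radius t"
  assume "satisfies frame.algebra (s, t)"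
  moreover have "?\<sigma> \<in> UNIV \<rightarrow> carrier frame.algebra"
    using \<rho> closed_ideal by auto
  ultimately have "eval frame.algebra ?\<sigma> s = eval frame.algebra ?\<sigma> t"
    by (simp add: satisfies_def)
  moreover have s: "approximates ?b (eval frame.algebra ?\<sigma> s) (eval A \<rho> s)"
    using k by (intro approximates_weaken[OF approximates_eval[OF \<rho>]]) auto
  moreover have t: "approximates ?b (eval frame.algebra ?\<sigma> t) (eval A \<rho> t)"
    using k by (intro approximates_weaken[OF approximates_eval[OF \<rho>]]) auto
  ultimately have "d \<preceq> eval A \<rho> s \<longleftrightarrow> d \<preceq> eval A \<rho> t" if "d \<in> carrier A" for d
    using approximatesD(4)[OF s, of ?b d] approximatesD(4)[OF t, of ?b d] that k by simp
  from this[of "eval A \<rho> s"] this[of "eval A \<rho> t"] have "eval A \<rho> s = eval A \<rho> t"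
    using eval_closed[OF \<rho>] by (simp add: le_refl le_antisym)
  with ne show False
    by contradiction
qed

end
section \<open>Two weak forms of idempotence\<close>

primrec power_term :: "rl_term \<Rightarrow> nat \<Rightarrow> rl_term" where
  "power_term t 0 = One"
| "power_term t (Suc n) = Mult (power_term t n) t"

definition le_law :: "rl_term \<Rightarrow> rl_term \<Rightarrow> rl_term \<times> rl_term" where
  "le_law s t = (Meet s t, s)"

definition potent_law :: "nat \<Rightarrow> rl_term \<times> rl_term" where
  "potent_law k = le_law (power_term (Var 0) k) (power_term (Var 0) (Suc k))"

text \<open>For an idempotent \<open>x\<close> the residual of \<open>x\<close> into its square is
  the unit, so the law leaves no idempotent but the unit.\<close>

definition square_law :: "nat \<Rightarrow> rl_term \<times> rl_term" where
  "square_law k =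
     le_law (power_term (LDiv (Var 0) (Mult (Var 0) (Var 0))) (Suc k)) (Var 0)"

context cirl
begin

lemma eval_power_term: "eval A \<rho> (power_term t n) = eval A \<rho> t [^] n"
  by (induction n) simp_all

lemma satisfies_potent_law:
  "satisfies A (potent_law k) \<longleftrightarrow> (\<forall>x\<in>carrier A. x [^] k \<preceq> x [^] Suc k)"
proof
  assume *: "satisfies A (potent_law k)"
  show "\<forall>x\<in>carrier A. x [^] k \<preceq> x [^] Suc k"
  proof
    fix x assume "x \<in> carrier A"
    then show "x [^] k \<preceq> x [^] Suc k"
      using bspec[OF *[unfolded satisfies_def], of "\<lambda>_. x"]
      by (simp add: potent_law_def le_law_def eval_power_term rl_le_def)
  qed
next
  assume *: "\<forall>x\<in>carrier A. x [^] k \<preceq> x [^] Suc k"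
  show "satisfies A (potent_law k)"
    unfolding satisfies_def
  proof
    fix \<rho> :: "nat \<Rightarrow> 'a" assume "\<rho> \<in> UNIV \<rightarrow> carrier A"
    then have "\<rho> 0 \<in> carrier A" by blast
    then show "eval A \<rho> (fst (potent_law k)) = eval A \<rho> (snd (potent_law k))"
      using * by (simp add: potent_law_def le_law_def eval_power_term rl_le_def)
  qed
qed

lemma satisfies_square_law:
  "satisfies A (square_law k) \<longleftrightarrow> (\<forall>x\<in>carrier A. (x \<setminus> (x \<otimes> x)) [^] Suc k \<preceq> x)"
proof
  assume *: "satisfies A (square_law k)"
  show "\<forall>x\<in>carrier A. (x \<setminus> (x \<otimes> x)) [^] Suc k \<preceq> x"
  proof
    fix x assume "x \<in> carrier A"
    then show "(x \<setminus> (x \<otimes> x)) [^] Suc k \<preceq> x"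
      using bspec[OF *[unfolded satisfies_def], of "\<lambda>_. x"]
      by (simp add: square_law_def le_law_def eval_power_term rl_le_def)
  qed
next
  assume *: "\<forall>x\<in>carrier A. (x \<setminus> (x \<otimes> x)) [^] Suc k \<preceq> x"
  show "satisfies A (square_law k)"
    unfolding satisfies_def
  proof
    fix \<rho> :: "nat \<Rightarrow> 'a" assume "\<rho> \<in> UNIV \<rightarrow> carrier A"
    then have "\<rho> 0 \<in> carrier A" by blast
    then show "eval A \<rho> (fst (square_law k)) = eval A \<rho> (snd (square_law k))"
      using * by (simp add: square_law_def le_law_def eval_power_term rl_le_def)
  qed
qed

lemma pow_Suc_le: "x \<in> carrier A \<Longrightarrow> x [^] Suc n \<preceq> x [^] (n :: nat)"
  by (simp add: mult_le)

lemma pow_antimono: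
  fixes m n :: nat
  assumes x: "x \<in> carrier A"
  shows "m \<le> n \<Longrightarrow> x [^] n \<preceq> x [^] m"
proof (induction rule: dec_induct)
  case base
  then show ?case using x by (simp add: le_refl)
next
  case (step n)
  then show ?case
    using le_trans[OF pow_Suc_le[OF x, of n] step.IH] x by simp
qed

text \<open>\<open>x [^] n\<close> is an idempotent below \<open>x\<close>, and the square law maps idempotents to the unit.\<close>

lemma square_law_stable_power:
  assumes sq: "satisfies A (square_law k)" and x: "x \<in> carrier A" and le: "x [^] (n :: nat) \<preceq> x [^] Suc n"
  shows "x = \<one>"
proof -
  let ?e = "x [^] n"
  have step: "?e \<otimes> x = ?e"
    using le_antisym[OF pow_Suc_le[OF x, of n] le] x by simp
  have "?e \<otimes> x [^] j = ?e" for j :: nat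
    using x step by (induction j) (simp_all flip: m_assoc)
  then have "?e \<otimes> ?e = ?e" .
  moreover have "?e \<setminus> ?e = \<one>"
    using x ldiv_residual[of ?e \<one> ?e] by (intro le_antisym le_one) (simp_all add: le_refl)
  moreover have "(?e \<setminus> (?e \<otimes> ?e)) [^] Suc k \<preceq> ?e"
    using sq x unfolding satisfies_square_law by blast
  ultimately have "\<one> \<preceq> ?e"
    by (simp del: nat_pow_Suc)
  then have "?e = \<one>"
    using le_antisym[of ?e \<one>] le_one x by simp
  then show ?thesis
    using step x by simp
qed

text \<open>By the pigeonhole principle two powers coincide, and as powers decrease, so do all those
  in between.\<close>

lemma finite_stable_power:
  assumes "finite (carrier A)" and x: "x \<in> carrier A"
  shows "\<exists>n :: nat. x [^] n \<preceq> x [^] Suc n"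
proof -
  have "range (\<lambda>n :: nat. x [^] n) \<subseteq> carrier A"
    using x by auto
  then have "finite (range (\<lambda>n :: nat. x [^] n))"
    using assms(1) finite_subset by blast
  then have "\<not> inj (\<lambda>n :: nat. x [^] n)"
    using finite_imageD infinite_UNIV_nat by blast
  then obtain m n :: nat where "m < n" "x [^] m = x [^] n"
    unfolding inj_def by (metis linorder_neqE_nat)
  then have "x [^] m \<preceq> x [^] Suc m"
    using pow_antimono[OF x, of "Suc m" n] by simp
  then show ?thesis ..
qed

end

section \<open>The two laws in algebras of graded ideals\<close>

context graded
begin

lemma cirl_frame: "cirl frame.algebra"
  by (rule frame.cirl_algebra)

lemma tail_mult: "\<lbrakk>x \<in> tail i; y \<in> tail j\<rbrakk> \<Longrightarrow> x \<otimes>\<^bsub>W\<^esub> y \<in> tail (i + j)"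
  by (auto simp: tail_def)

lemma closed_pow: "closed P \<Longrightarrow> closed (P [^]\<^bsub>frame.algebra\<^esub> (n :: nat))"
proof -
  interpret D: cirl frame.algebra by (rule cirl_frame)
  show "closed P \<Longrightarrow> closed (P [^]\<^bsub>frame.algebra\<^esub> (n :: nat))"
    using D.nat_pow_closed[of P n] by simp
qed

text \<open>Closedness of the tails is assumed because a constant \<open>g\<close> provides it only
  up to degree \<open>k\<close>. The index starts at 1 since \<open>tail 0\<close> may contain pairs
  outside \<open>W\<close>; the power 0 is all of \<open>W\<close> and is treated directly.\<close>

lemma pow_subset_tail:
  assumes P: "closed P" "P \<subseteq> tail m"
  shows "(\<And>i. \<lbrakk>1 \<le> i; i \<le> n\<rbrakk> \<Longrightarrow> closed (tail (i * m))) \<Longrightarrow>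
    P [^]\<^bsub>frame.algebra\<^esub> (n :: nat) \<subseteq> tail (n * m)"
proof (induction n)
  case 0
  interpret D: cirl frame.algebra by (rule cirl_frame)
  show ?case
    using frame.K_subset[of "carrier W"] closed_carrier by (auto simp: tail_def)
next
  case (Suc n)
  interpret D: cirl frame.algebra by (rule cirl_frame)
  have IH: "P [^]\<^bsub>frame.algebra\<^esub> n \<subseteq> tail (n * m)"
    using Suc by simp
  have "frame.product (P [^]\<^bsub>frame.algebra\<^esub> n) P \<subseteq> tail (Suc n * m)"
  proof (subst frame.product_subset_iff)
    show "tail (Suc n * m) \<in> Collect closed"
      using Suc.prems[of "Suc n"] by simp
    show "\<forall>x\<in>P [^]\<^bsub>frame.algebra\<^esub> n. \<forall>y\<in>P. x \<otimes>\<^bsub>W\<^esub> y \<in> tail (Suc n * m)"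
      unfolding mult_Suc add.commute[of m] using IH P(2) tail_mult by blast
  qed
  then show ?case
    by simp
qed

lemma closed_eq_carrier:
  assumes "closed P" "(c, 0) \<in> P"
  shows "P = carrier W"
proof
  show "P \<subseteq> carrier W"
    using frame.K_subset assms(1) by simp
  have "(\<one>, 0) \<in> P"
    using closed_in(2)[OF assms] assms(2) by simp
  then show "carrier W \<subseteq> P"
    using closed_down[OF assms(1), of \<one> 0] le_one by auto
qed

lemma square_law_algebra:
  assumes g: "g = (\<lambda>n. k + n)"
  shows "satisfies frame.algebra (square_law k)"
proof -
  interpret D: cirl frame.algebra by (rule cirl_frame)
  have "frame.residual P (frame.product P P) [^]\<^bsub>frame.algebra\<^esub> Suc k \<subseteq> P" (is "?F [^]\<^bsub>_\<^esub> _ \<subseteq> _")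
    if P: "closed P" for P
  proof -
    have F: "closed ?F"
      using frame.residual_closed frame.product_closed P by simp
    \<comment> \<open>The lowest degree of \<open>P\<close> controls everything: the residual of
      \<open>P\<close> into its square also lives in degrees at least \<open>m\<close>.\<close>
    define m where "m = (LEAST m. \<exists>c. (c, m) \<in> P)"
    have "\<exists>m c. (c, m) \<in> P"
      using closed_nonempty[OF P] by auto
    from LeastI_ex[OF this] obtain c where c: "(c, m) \<in> P"
      unfolding m_def by blast
    have "m \<le> n" if "(d, n) \<in> P" for d n
      unfolding m_def using that by (blast intro: Least_le)
    then have P_tail: "P \<subseteq> tail m"
      using closed_in(1)[OF P] by (auto simp: tail_def)
    show ?thesis
    proof (cases "m = 0")
      case True
      then have "P = carrier W"
        using closed_eq_carrier P c by blast
      then show ?thesis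
        using frame.K_subset closed_pow[OF F, of "Suc k"] by blast
    next
      case False
      have tails: "closed (tail j)" if "1 \<le> j" for j
        using that by (intro closed_tail) (simp_all add: g)
      have "\<forall>x\<in>P. \<forall>y\<in>P. x \<otimes>\<^bsub>W\<^esub> y \<in> tail (m + m)"
        using P_tail tail_mult by blast
      then have "frame.product P P \<subseteq> tail (m + m)"
        using frame.product_subset_iff[of "tail (m + m)" P P] tails[of "m + m"] False by simp
      \<comment> \<open>Testing \<open>(e, n)\<close> against the element \<open>(c, m)\<close> of
        lowest degree gives \<open>m + n >= m + m\<close>.\<close>
      moreover have "(c \<otimes> e, m + n) \<in> frame.product P P" if "(e, n) \<in> ?F" for e n
        using that c by (fastforce simp: frame.residual_def)
      ultimately have "?F \<subseteq> tail m"
        using closed_in(1)[OF F] by (fastforce simp: tail_def)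
      then have "?F [^]\<^bsub>frame.algebra\<^esub> Suc k \<subseteq> tail (Suc k * m)"
        using False tails by (intro pow_subset_tail F) simp_all
      also have "\<dots> \<subseteq> P"
      proof (rule subrelI)
        \<comment> \<open>Since \<open>1 <= m\<close>, the cut-off \<open>k + m\<close> is at most
          \<open>k * m + m\<close>; hence the exponent \<open>Suc k\<close> in the law.\<close>
        have "g m \<le> Suc k * m"
          using False by (cases m) (simp_all add: g)
        then show "(d, n) \<in> P" if "(d, n) \<in> tail (Suc k * m)" for d n
          using closed_cut[OF P c, of n d] that by (simp add: tail_def)
      qed
      finally show ?thesis .
    qed
  qed
  then show ?thesis
    unfolding D.satisfies_square_law by (simp del: D.nat_pow_Suc)
qed

lemma potent_law_algebra:
  assumes g: "g = (\<lambda>n. k)"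
  shows "satisfies frame.algebra (potent_law k)"
proof -
  interpret D: cirl frame.algebra by (rule cirl_frame)
  have "P [^]\<^bsub>frame.algebra\<^esub> k \<subseteq> P [^]\<^bsub>frame.algebra\<^esub> Suc k" if P: "closed P" for P
  proof (cases "\<exists>c. (c, 0) \<in> P")
    case True
    then have "P = \<one>\<^bsub>frame.algebra\<^esub>"
      using closed_eq_carrier[OF P] by auto
    then show ?thesis
      by (simp only: D.nat_pow_one)
  next
    case False
    then have "n \<noteq> 0" if "(d, n) \<in> P" for d n
      using that by (metis)
    then have "P \<subseteq> tail 1"
      using closed_in(1)[OF P] by (fastforce simp: tail_def)
    then have "P [^]\<^bsub>frame.algebra\<^esub> k \<subseteq> tail (k * 1)"
      by (intro pow_subset_tail P closed_tail) (simp_all add: g)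
    \<comment> \<open>With constant cut-off \<open>k\<close>, every closed set, being nonempty,
      contains all elements of degree at least \<open>k\<close>.\<close>
    also have "\<dots> \<subseteq> P [^]\<^bsub>frame.algebra\<^esub> Suc k" (is "_ \<subseteq> ?Q")
    proof (rule subrelI)
      have Q: "closed ?Q"
        using P by (rule closed_pow)
      then obtain c n where "(c, n) \<in> ?Q"
        using closed_nonempty by (metis ex_in_conv surj_pair)
      then show "(d, m) \<in> ?Q" if "(d, m) \<in> tail (k * 1)" for d m
        using closed_cut[OF Q, of c n m d] that by (simp add: tail_def g del: D.nat_pow_Suc)
    qed
    finally show ?thesis .
  qed
  then show ?thesis
    unfolding D.satisfies_potent_law by (simp del: D.nat_pow_Suc)
qed

end
section \<open>Copies of countable subalgebras\<close>

instance rl_term :: countable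
  by countable_datatype

definition image_algebra :: "('a, 'b) rlat_scheme \<Rightarrow> 'a set \<Rightarrow> ('a \<Rightarrow> 'u) \<Rightarrow> 'u rlat" where
  "image_algebra A S h = (let g = inv_into S h in
     \<lparr>carrier = h ` S, monoid.mult = (\<lambda>x y. h (g x \<otimes>\<^bsub>A\<^esub> g y)), one = h \<one>\<^bsub>A\<^esub>,
      rl_meet = (\<lambda>x y. h (g x \<curlywedge>\<^bsub>A\<^esub> g y)), rl_join = (\<lambda>x y. h (g x \<curlyvee>\<^bsub>A\<^esub> g y)),
      ldiv = (\<lambda>x y. h (g x \<setminus>\<^bsub>A\<^esub> g y)), rdiv = (\<lambda>x y. h (g x \<div>\<^bsub>A\<^esub> g y))\<rparr>)"

locale copied_subalgebra = cirl +
  fixes S :: "'a set" and h :: "'a \<Rightarrow> 'u"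
  assumes S: "subuniverse A S" and inj: "inj_on h S"
begin

abbreviation B :: "'u rlat" where
  "B \<equiv> image_algebra A S h"

lemma S_closed [simp]:
  "x \<in> S \<Longrightarrow> x \<in> carrier A" "\<one> \<in> S"
  "\<lbrakk>x \<in> S; y \<in> S\<rbrakk> \<Longrightarrow> x \<otimes> y \<in> S" "\<lbrakk>x \<in> S; y \<in> S\<rbrakk> \<Longrightarrow> x \<curlywedge> y \<in> S"
  "\<lbrakk>x \<in> S; y \<in> S\<rbrakk> \<Longrightarrow> x \<curlyvee> y \<in> S" "\<lbrakk>x \<in> S; y \<in> S\<rbrakk> \<Longrightarrow> x \<setminus> y \<in> S"
  "\<lbrakk>x \<in> S; y \<in> S\<rbrakk> \<Longrightarrow> x \<div> y \<in> S"
  using S unfolding subuniverse_def by blast+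

lemma B_simps [simp]:
  "carrier B = h ` S" "\<one>\<^bsub>B\<^esub> = h \<one>"
  "\<lbrakk>x \<in> S; y \<in> S\<rbrakk> \<Longrightarrow> h x \<otimes>\<^bsub>B\<^esub> h y = h (x \<otimes> y)"
  "\<lbrakk>x \<in> S; y \<in> S\<rbrakk> \<Longrightarrow> h x \<curlywedge>\<^bsub>B\<^esub> h y = h (x \<curlywedge> y)"
  "\<lbrakk>x \<in> S; y \<in> S\<rbrakk> \<Longrightarrow> h x \<curlyvee>\<^bsub>B\<^esub> h y = h (x \<curlyvee> y)"
  "\<lbrakk>x \<in> S; y \<in> S\<rbrakk> \<Longrightarrow> h x \<setminus>\<^bsub>B\<^esub> h y = h (x \<setminus> y)"
  "\<lbrakk>x \<in> S; y \<in> S\<rbrakk> \<Longrightarrow> h x \<div>\<^bsub>B\<^esub> h y = h (x \<div> y)"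
  using inj by (simp_all add: image_algebra_def Let_def inv_into_f_f)

lemma B_le [simp]: "\<lbrakk>x \<in> S; y \<in> S\<rbrakk> \<Longrightarrow> h x \<preceq>\<^bsub>B\<^esub> h y \<longleftrightarrow> x \<preceq> y"
  using inj by (simp add: rl_le_def inj_on_eq_iff)

lemma cirl_B: "cirl B"
proof (unfold_locales, unfold B_simps(1))
  fix x y z assume "x \<in> h ` S" "y \<in> h ` S" "z \<in> h ` S"
  then show "(x \<otimes>\<^bsub>B\<^esub> y) \<otimes>\<^bsub>B\<^esub> z = x \<otimes>\<^bsub>B\<^esub> (y \<otimes>\<^bsub>B\<^esub> z)"
    "(x \<curlywedge>\<^bsub>B\<^esub> y) \<curlywedge>\<^bsub>B\<^esub> z = x \<curlywedge>\<^bsub>B\<^esub> (y \<curlywedge>\<^bsub>B\<^esub> z)"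
    "(x \<curlyvee>\<^bsub>B\<^esub> y) \<curlyvee>\<^bsub>B\<^esub> z = x \<curlyvee>\<^bsub>B\<^esub> (y \<curlyvee>\<^bsub>B\<^esub> z)"
    "(y \<preceq>\<^bsub>B\<^esub> x \<setminus>\<^bsub>B\<^esub> z) = (x \<otimes>\<^bsub>B\<^esub> y \<preceq>\<^bsub>B\<^esub> z)"
    "(x \<otimes>\<^bsub>B\<^esub> y \<preceq>\<^bsub>B\<^esub> z) = (x \<preceq>\<^bsub>B\<^esub> z \<div>\<^bsub>B\<^esub> y)"
    by (auto simp: m_assoc meet_assoc join_assoc ldiv_residual rdiv_residual)
next
  fix x y assume "x \<in> h ` S" "y \<in> h ` S"
  then show "x \<curlywedge>\<^bsub>B\<^esub> y = y \<curlywedge>\<^bsub>B\<^esub> x" "x \<curlyvee>\<^bsub>B\<^esub> y = y \<curlyvee>\<^bsub>B\<^esub> x"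
    "x \<otimes>\<^bsub>B\<^esub> y = y \<otimes>\<^bsub>B\<^esub> x"
    "x \<curlywedge>\<^bsub>B\<^esub> (x \<curlyvee>\<^bsub>B\<^esub> y) = x" "x \<curlyvee>\<^bsub>B\<^esub> (x \<curlywedge>\<^bsub>B\<^esub> y) = x"
    using meet_comm join_comm mult_comm meet_absorb join_absorb S_closed(1) by fastforce+
qed (auto simp: le_one)

lemma eval_B:
  fixes \<sigma> :: "nat \<Rightarrow> 'a"
  assumes "\<sigma> \<in> UNIV \<rightarrow> S"
  shows "eval A \<sigma> t \<in> S \<and> eval B (h \<circ> \<sigma>) t = h (eval A \<sigma> t)"
  using assms by (induction t) auto

lemma satisfies_B:
  assumes "satisfies A e"
  shows "satisfies B e"
  unfolding satisfies_def
proof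
  fix \<rho> :: "nat \<Rightarrow> 'u" assume "\<rho> \<in> UNIV \<rightarrow> carrier B"
  then have "\<forall>n. \<exists>x. x \<in> S \<and> \<rho> n = h x"
    by auto
  then obtain \<sigma> where \<sigma>: "\<And>n. \<sigma> n \<in> S" "\<And>n. \<rho> n = h (\<sigma> n)"
    by metis
  then have "\<rho> = h \<circ> \<sigma>"
    by auto
  moreover have "eval A \<sigma> (fst e) = eval A \<sigma> (snd e)"
    using assms \<sigma>(1) by (simp add: satisfies_def)
  ultimately show "eval B \<rho> (fst e) = eval B \<rho> (snd e)"
    using eval_B[of \<sigma>] \<sigma>(1) by simp
qed

end

text \<open>Algebras of graded ideals live on another type than the members of varieties over
  \<open>'u\<close>. The values of all terms under a refuting valuation form a countable subalgebra,
  which embeds into any infinite type and still refutes \<open>e\<close>.\<close>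

lemma cirl_copy:
  assumes A: "cirl A" and e: "\<not> satisfies A e"
  shows "\<exists>B \<in> CIRL :: 'u::infinite rlat set. \<not> satisfies B e \<and>
    (\<forall>e'. satisfies A e' \<longrightarrow> satisfies B e')"
proof -
  interpret cirl A by (rule A)
  obtain \<rho> where \<rho>: "\<rho> \<in> UNIV \<rightarrow> carrier A" and ne: "eval A \<rho> (fst e) \<noteq> eval A \<rho> (snd e)"
    using e by (auto simp: satisfies_def)
  define S where "S = range (eval A \<rho>)"
  obtain f :: "nat \<Rightarrow> 'u" where f: "inj f"
    using infinite_countable_subset[OF infinite_UNIV] by blast
  define h where "h = f \<circ> to_nat_on S"
  have "countable S"
    by (simp add: S_def)
  then have inj: "inj_on h S"
    unfolding h_def using f by (intro comp_inj_on inj_on_to_nat_on) (auto intro: inj_on_subset)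
  have "eval A \<rho> One = \<one>\<^bsub>A\<^esub>"
    by simp
  then have "\<one>\<^bsub>A\<^esub> \<in> S"
    unfolding S_def by (metis rangeI)
  moreover have "x \<otimes>\<^bsub>A\<^esub> y \<in> S \<and> x \<curlywedge>\<^bsub>A\<^esub> y \<in> S \<and> x \<curlyvee>\<^bsub>A\<^esub> y \<in> S \<and> x \<setminus>\<^bsub>A\<^esub> y \<in> S \<and> x \<div>\<^bsub>A\<^esub> y \<in> S"
    if "x \<in> S" "y \<in> S" for x y
  proof -
    obtain s t where "x = eval A \<rho> s" "y = eval A \<rho> t"
      using \<open>x \<in> S\<close> \<open>y \<in> S\<close> by (auto simp: S_def)
    then show ?thesis
      unfolding S_def by (metis eval.simps(3-7) rangeI)
  qed
  ultimately have "subuniverse A S"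
    using eval_closed[OF \<rho>] by (auto simp: subuniverse_def S_def)
  then interpret copied_subalgebra A S h
    using inj by unfold_locales
  have \<rho>S: "\<rho> \<in> UNIV \<rightarrow> S"
    unfolding S_def by (metis Pi_I eval.simps(1) rangeI)
  have "eval B (h \<circ> \<rho>) (fst e) \<noteq> eval B (h \<circ> \<rho>) (snd e)"
    using eval_B[OF \<rho>S] ne inj by (simp add: inj_on_eq_iff)
  moreover have "h \<circ> \<rho> \<in> UNIV \<rightarrow> carrier B"
    using \<rho>S by auto
  ultimately have "\<not> satisfies B e"
    unfolding satisfies_def by blast
  then show ?thesis
    using cirl_B satisfies_B by (auto simp: CIRL_iff_cirl)
qed

section \<open>Splittings\<close>

text \<open>Thus the subvarieties cut out by the square laws have join \<open>CIRL\<close>. The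
  cut-off \<open>?k\<close> is large enough for both sides of \<open>e\<close>, and the slope of
  \<open>n\<close> in \<open>?k + n\<close> is what the square law needs.\<close>

lemma CIRL_fails_square_law:
  assumes A: "A \<in> (CIRL :: 'u::infinite rlat set)" and e: "\<not> satisfies A e"
  shows "\<exists>B \<in> CIRL :: 'u rlat set. \<exists>k. \<not> satisfies B e \<and> satisfies B (square_law k)"
proof -
  let ?k = "2 * (radius (fst e) + radius (snd e))"
  interpret cirl A
    using A by (simp add: CIRL_iff_cirl)
  interpret graded A ?k "\<lambda>n. ?k + n"
    using radius_pos[of "fst e"] by unfold_locales auto
  have "\<not> satisfies frame.algebra e"
    using e fails_algebra[of _ "fst e" "snd e"] by (auto simp: satisfies_def[of A])
  then show ?thesis
    using cirl_copy[OF cirl_frame] square_law_algebra by blast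
qed

lemma CIRL_fails_potent_law:
  assumes A: "A \<in> (CIRL :: 'u::infinite rlat set)" and e: "\<not> satisfies A e"
  shows "\<exists>B \<in> CIRL :: 'u rlat set. \<exists>k. \<not> satisfies B e \<and> satisfies B (potent_law k)"
proof -
  let ?k = "2 * (radius (fst e) + radius (snd e))"
  interpret cirl A
    using A by (simp add: CIRL_iff_cirl)
  interpret graded A ?k "\<lambda>n. ?k"
    using radius_pos[of "fst e"] by unfold_locales auto
  have "\<not> satisfies frame.algebra e"
    using e fails_algebra[of _ "fst e" "snd e"] by (auto simp: satisfies_def[of A])
  then show ?thesis
    using cirl_copy[OF cirl_frame] potent_law_algebra by blast
qed

lemma variety_CIRL_satisfies: "variety {A \<in> (CIRL :: 'u::infinite rlat set). satisfies A e}"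
proof -
  have "variety (\<Inter>{CIRL :: 'u rlat set, models {e}})"
    using variety_CIRL by (intro variety_Inter) (auto simp: variety_def)
  moreover have "\<Inter>{CIRL :: 'u rlat set, models {e}} = {A \<in> CIRL. satisfies A e}"
    by (auto simp: models_def CIRL_def)
  ultimately show ?thesis
    by simp
qed

lemma variety_fails:
  assumes "variety V" "residuated_lattice A" "A \<notin> V"
  obtains e where "\<not> satisfies A e" "\<And>B. B \<in> V \<Longrightarrow> satisfies B e"
  using assms unfolding variety_def models_def by blast

lemma trivial_in_variety:
  assumes V: "variety V" and A: "residuated_lattice A" and triv: "carrier A = {\<one>\<^bsub>A\<^esub>}"
  shows "A \<in> V"
proof (rule ccontr)
  interpret residuated_lattice A by (rule A)
  assume "A \<notin> V"
  then obtain e where e: "\<not> satisfies A e"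
    using variety_fails[OF V A] by blast
  have "eval A \<rho> t = \<one>\<^bsub>A\<^esub>" if "\<rho> \<in> UNIV \<rightarrow> carrier A" for \<rho> t
  proof -
    have "eval A \<rho> t \<in> carrier A"
      using that by (induction t) auto
    then show ?thesis
      using triv by simp
  qed
  then show False
    using e by (simp add: satisfies_def)
qed

lemma not_splitting_algebra:
  assumes R: "variety (R :: 'u::infinite rlat set)" "CIRL \<subseteq> R"
    and A: "A \<in> CIRL" "finite (carrier A)"
  shows "\<not> splitting_algebra R A"
proof
  let ?L = "subvarieties R"
  assume "splitting_algebra R A"
  then have prime: "\<exists>s\<in>S. generated_variety A \<subseteq> s"
    if "S \<subseteq> carrier ?L" "generated_variety A \<subseteq> \<Squnion>\<^bsub>?L\<^esub> S" for S
    using that by (auto simp: splitting_algebra_def completely_join_prime_def subvarieties_def)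
  interpret L: complete_lattice ?L
    using R(1) by (rule complete_lattice_subvarieties)
  interpret cirl A
    using A(1) by (simp add: CIRL_iff_cirl)
  have sup_variety: "variety (\<Squnion>\<^bsub>?L\<^esub> S)" if "S \<subseteq> carrier ?L" for S
    using L.sup_closed[OF that] by (simp add: subvarieties_def)
  have generated: "generated_variety A \<subseteq> V" if "variety V" "A \<in> V" for V
    using that by (auto simp: generated_variety_def)
  show False
  proof (cases "carrier A = {\<one>\<^bsub>A\<^esub>}")
    \<comment> \<open>One-element algebras count as subdirectly irreducible here; they lie in the
      empty join, which refutes primeness.\<close>
    case True
    have "A \<in> \<Squnion>\<^bsub>?L\<^esub> {}"
      using sup_variety[of "{}"] True residuated_lattice_axioms by (intro trivial_in_variety) auto
    then show False
      using prime[of "{}"] generated[OF sup_variety[of "{}"]] by blast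
  next
    case False
    then obtain a where a: "a \<in> carrier A" "a \<noteq> \<one>\<^bsub>A\<^esub>"
      by blast
    define S where "S = range (\<lambda>k. {B \<in> CIRL :: 'u rlat set. satisfies B (square_law k)})"
    have S: "S \<subseteq> carrier ?L"
      using R(2) variety_CIRL_satisfies[of "square_law _"] by (auto simp: S_def subvarieties_def)
    have "A \<in> \<Squnion>\<^bsub>?L\<^esub> S"
    proof (rule ccontr)
      assume "A \<notin> \<Squnion>\<^bsub>?L\<^esub> S"
      \<comment> \<open>An identity of the join that fails in \<open>A\<close> would fail in some
        \<open>B\<close> obeying a square law, yet \<open>B\<close> belongs to the join.\<close>
      then obtain e where e: "\<not> satisfies A e" "\<And>B. B \<in> \<Squnion>\<^bsub>?L\<^esub> S \<Longrightarrow> satisfies B e"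
        using variety_fails[OF sup_variety[OF S] residuated_lattice_axioms] by metis
      obtain B :: "'u rlat" and k
        where B: "B \<in> CIRL" "\<not> satisfies B e" "satisfies B (square_law k)"
        using CIRL_fails_square_law[OF A(1) e(1)] by blast
      have "{B \<in> CIRL :: 'u rlat set. satisfies B (square_law k)} \<subseteq> \<Squnion>\<^bsub>?L\<^esub> S"
        using L.sup_upper[OF S] by (auto simp: S_def subvarieties_def)
      then show False
        using B e(2) by blast
    qed
    then have "generated_variety A \<subseteq> \<Squnion>\<^bsub>?L\<^esub> S"
      using generated sup_variety[OF S] by blast
    \<comment> \<open>Primeness selects one square law for \<open>A\<close>; finiteness supplies a
      stable power of \<open>a\<close>, and together they force \<open>a\<close> to be the
      unit.\<close>
    then obtain k where "generated_variety A \<subseteq> {B \<in> CIRL. satisfies B (square_law k)}"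
      using prime[OF S] by (auto simp: S_def)
    then have "satisfies A (square_law k)"
      by (auto simp: generated_variety_def)
    then show False
      using square_law_stable_power[OF _ a(1)] finite_stable_power[OF A(2) a(1)] a(2) by blast
  qed
qed

text \<open>A member of \<open>c\<close> may be infinite, so its stable powers cannot come from
  finiteness. The potent laws supply them: the splitting forces \<open>C\<close> to satisfy a law of
  each family.\<close>

lemma no_splitting_pair_CIRL:
  "\<not> splitting_pair (subvarieties (CIRL :: 'u::infinite rlat set)) c d"
proof
  assume "splitting_pair (subvarieties (CIRL :: 'u rlat set)) c d"
  then have c: "variety c" "c \<subseteq> CIRL" and d: "variety d" "d \<subseteq> CIRL"
    and split: "\<And>V. \<lbrakk>variety V; V \<subseteq> CIRL\<rbrakk> \<Longrightarrow> c \<subseteq> V \<or> V \<subseteq> d"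
    and disjoint: "\<And>V. \<lbrakk>variety V; V \<subseteq> CIRL; c \<subseteq> V\<rbrakk> \<Longrightarrow> \<not> V \<subseteq> d"
    unfolding splitting_pair_def subvarieties_def by auto
  obtain C where C: "C \<in> c" "C \<notin> d"
    using disjoint[OF c] by blast
  interpret C: cirl C
    using c(2) C(1) by (auto simp: CIRL_iff_cirl)
  have "carrier C \<noteq> {\<one>\<^bsub>C\<^esub>}"
    using trivial_in_variety[OF d(1) C.residuated_lattice_axioms] C(2) by blast
  then obtain a where a: "a \<in> carrier C" "a \<noteq> \<one>\<^bsub>C\<^esub>"
    by blast
  obtain A where A: "A \<in> CIRL" "A \<notin> d"
    using disjoint[OF variety_CIRL _ c(2)] by blast
  then obtain e where e: "\<not> satisfies A e" "\<And>B. B \<in> d \<Longrightarrow> satisfies B e"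
    using variety_fails[OF d(1)] by (metis CIRL_iff_cirl cirl_iff)
  \<comment> \<open>The subvariety given by \<open>e'\<close> contains \<open>B\<close>, which
    violates the identity \<open>e\<close> of \<open>d\<close>. It is therefore not below
    \<open>d\<close>, so it lies above \<open>c\<close>.\<close>
  have transfer: "satisfies C e'" if "B \<in> CIRL" "\<not> satisfies B e" "satisfies B e'"
    for B :: "'u rlat" and e'
  proof -
    let ?V = "{A \<in> CIRL :: 'u rlat set. satisfies A e'}"
    have "c \<subseteq> ?V \<or> ?V \<subseteq> d"
      using variety_CIRL_satisfies by (rule split) blast
    moreover have "B \<in> ?V" "B \<notin> d"
      using that e(2) by auto
    ultimately show ?thesis
      using C(1) by blast
  qed
  obtain k where "satisfies C (square_law k)"
    using CIRL_fails_square_law[OF A(1) e(1)] transfer by blast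
  moreover obtain n where "satisfies C (potent_law n)"
    using CIRL_fails_potent_law[OF A(1) e(1)] transfer by blast
  ultimately show False
    using C.square_law_stable_power[OF _ a(1)] a C.satisfies_potent_law by blast
qed

theorem corollary5p20:
  shows "(\<forall>(R :: 'u::infinite rlat set) A.
            variety R \<and> CIRL \<subseteq> R \<and> A \<in> R \<and> finite (carrier A) \<and>
            subdirectly_irreducible A \<and> commutative A \<and> integral A \<longrightarrow>
            \<not> splitting_algebra R A) \<and>
         (\<nexists>c d. splitting_pair (subvarieties (CIRL :: 'u rlat set)) c d)"
proof (intro conjI allI impI)
  fix R :: "'u rlat set" and A
  assume A: "variety R \<and> CIRL \<subseteq> R \<and> A \<in> R \<and> finite (carrier A) \<and>
    subdirectly_irreducible A \<and> commutative A \<and> integral A"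
  then have "A \<in> CIRL"
    by (auto simp: CIRL_def variety_def models_def)
  then show "\<not> splitting_algebra R A"
    using A by (intro not_splitting_algebra) auto
qed (use no_splitting_pair_CIRL in blast)

end
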